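(* There is a polynomial-time algorithm that, given an interval graph $G$ and two independent sets $I$ and $J$ of $G$ of size $k$, decides whether $I$ and $J$ lie in the same connected component of the $k$-TS reconfiguration graph $TS_k(G)$.
   Context: An interval graph is the intersection graph of a family of intervals of the real line. The $k$-TS reconfiguration graph $TS_k(G)$ has as vertices the independent sets of $G$ of size exactly $k$, and two such sets $I,J$ are adjacent if $I\setminus J=\{v\}$, $J\setminus I=\{u\}$ and $uv$ is an edge of $G$. *)

theory Defs
  imports
    "HOL-Analysis.Analysis"
    "HOL-Computational_Algebra.Polynomial"
    "Graph_Theory.Graph_Theory"
begin

section \<open>Interval graphs and token sliding\<close>

text \<open>A finite simple graph is a \<^const>\<open>pair_graph\<close>: a finite, loop-free digraph in which the
  edge \<open>uv\<close> is represented by the two arcs \<open>(u, v)\<close> and \<open>(v, u)\<close>.\<close>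

definition interval_graph :: "'a pair_pre_digraph \<Rightarrow> bool" where
  "interval_graph G \<longleftrightarrow> pair_graph G \<and>
     (\<exists>S :: 'a \<Rightarrow> real set.
        (\<forall>v \<in> pverts G. is_interval (S v) \<and> S v \<noteq> {}) \<and>
        (\<forall>u \<in> pverts G. \<forall>v \<in> pverts G. u \<noteq> v \<longrightarrow>
           ((u, v) \<in> parcs G \<longleftrightarrow> S u \<inter> S v \<noteq> {})))"

definition independent_sets :: "'a pair_pre_digraph \<Rightarrow> nat \<Rightarrow> 'a set set" where
  "independent_sets G k =
     {I. I \<subseteq> pverts G \<and> card I = k \<and> (\<forall>u \<in> I. \<forall>v \<in> I. (u, v) \<notin> parcs G)}"

definition TS :: "nat \<Rightarrow> 'a pair_pre_digraph \<Rightarrow> 'a set pair_pre_digraph" where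
  "TS k G = \<lparr> pverts = independent_sets G k,
              parcs = {(I, J). I \<in> independent_sets G k \<and> J \<in> independent_sets G k \<and>
                         (\<exists>u v. I - J = {v} \<and> J - I = {u} \<and> (u, v) \<in> parcs G)} \<rparr>"

lemma pair_graph_TS:
  assumes "pair_graph G"
  shows "pair_graph (TS k G)"
proof -
  interpret pair_graph G by fact
  have s: "(u, v) \<in> parcs G \<Longrightarrow> (v, u) \<in> parcs G" for u v
    using pair_sym_arcs by (auto simp: symmetric_def sym_def)
  have fin: "finite (independent_sets G k)"
    by (rule finite_subset[of _ "Pow (pverts G)"]) (auto simp: independent_sets_def)
  have arcs: "parcs (TS k G) \<subseteq> independent_sets G k \<times> independent_sets G k"
    by (auto simp: TS_def)
  show ?thesis
  proof
    show "finite (parcs (TS k G))"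
      using arcs fin by (meson finite_SigmaI finite_subset)
    show "symmetric (with_proj (TS k G))"
      unfolding symmetric_def with_proj_simps
    proof (rule symI)
      fix I J assume "(I, J) \<in> parcs (TS k G)"
      then obtain u v where "I \<in> independent_sets G k" "J \<in> independent_sets G k"
        "I - J = {v}" "J - I = {u}" "(u, v) \<in> parcs G"
        unfolding TS_def by auto
      with s[of u v] show "(J, I) \<in> parcs (TS k G)"
        unfolding TS_def by simp
    qed
    fix e assume e: "e \<in> parcs (TS k G)"
    show "fst e \<in> pverts (TS k G)" "snd e \<in> pverts (TS k G)"
      using e arcs by (auto simp: TS_def)
    obtain v where "fst e - snd e = {v}"
      using e unfolding TS_def by auto
    then show "fst e \<noteq> snd e"
      by (metis Diff_cancel insert_not_empty)
  qed (simp add: TS_def fin)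
qed

text \<open>The graph \<open>TS k G\<close> is symmetric, so its strongly connected components are its connected
  components.\<close>

definition same_component :: "'a pair_pre_digraph \<Rightarrow> 'a \<Rightarrow> 'a \<Rightarrow> bool" where
  "same_component H x y \<longleftrightarrow>
     (\<exists>C \<in> pre_digraph.sccs_verts (with_proj H). x \<in> C \<and> y \<in> C)"

section \<open>Machine model\<close>

text \<open>Algorithms are programs of a first-order, call-by-value functional language over LISP
  data, with one time unit per evaluated construct. There are no primitives besides
  constructing, destructing and branching on pairs. A value can be represented by
  a pointer into a heap of shared cells, a step allocates at most one cell, and the length of an
  environment is bounded by a constant of the program; hence \<open>t\<close> steps can be simulated by a
  Turing machine in time polynomial in \<open>t\<close> and the input size, and conversely the language
  simulates a Turing machine with constant overhead per step.\<close>

datatype sexp = SNil | SCons sexp sexp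

datatype expr =
    Var nat
  | MkNil
  | MkCons expr expr
  | Hd expr
  | Tl expr
  | Cond expr expr expr
  | Call nat "expr list"

text \<open>A program is the list of the bodies of its functions. \<open>Call f es\<close> refers to the \<open>f\<close>-th body,
  and \<open>Var i\<close> inside a body to the \<open>i\<close>-th actual parameter.\<close>

type_synonym program = "expr list"

primrec shd :: "sexp \<Rightarrow> sexp" where
  "shd SNil = SNil"
| "shd (SCons a b) = a"

primrec stl :: "sexp \<Rightarrow> sexp" where
  "stl SNil = SNil"
| "stl (SCons a b) = b"

text \<open>\<open>eval P env e v t\<close>: in environment \<open>env\<close>, the expression \<open>e\<close> evaluates to \<open>v\<close> in \<open>t\<close> steps.
  Divergence and errors (unbound variables or functions) amount to the absence of a derivation.\<close>

inductive eval :: "program \<Rightarrow> sexp list \<Rightarrow> expr \<Rightarrow> sexp \<Rightarrow> nat \<Rightarrow> bool"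
  and evals :: "program \<Rightarrow> sexp list \<Rightarrow> expr list \<Rightarrow> sexp list \<Rightarrow> nat \<Rightarrow> bool"
  for P :: program where
  eval_Var: "i < length env \<Longrightarrow> eval P env (Var i) (env ! i) 1"
| eval_Nil: "eval P env MkNil SNil 1"
| eval_Cons: "eval P env e1 v1 t1 \<Longrightarrow> eval P env e2 v2 t2 \<Longrightarrow>
    eval P env (MkCons e1 e2) (SCons v1 v2) (t1 + t2 + 1)"
| eval_Hd: "eval P env e v t \<Longrightarrow> eval P env (Hd e) (shd v) (t + 1)"
| eval_Tl: "eval P env e v t \<Longrightarrow> eval P env (Tl e) (stl v) (t + 1)"
| eval_Cond_then: "eval P env e v t \<Longrightarrow> v \<noteq> SNil \<Longrightarrow> eval P env e1 v1 t1 \<Longrightarrow>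
    eval P env (Cond e e1 e2) v1 (t + t1 + 1)"
| eval_Cond_else: "eval P env e SNil t \<Longrightarrow> eval P env e2 v2 t2 \<Longrightarrow>
    eval P env (Cond e e1 e2) v2 (t + t2 + 1)"
| eval_Call: "evals P env es vs t1 \<Longrightarrow> f < length P \<Longrightarrow> eval P vs (P ! f) v t2 \<Longrightarrow>
    eval P env (Call f es) v (t1 + t2 + 1)"
| evals_Nil: "evals P env [] [] 0"
| evals_Cons: "eval P env e v t1 \<Longrightarrow> evals P env es vs t2 \<Longrightarrow>
    evals P env (e # es) (v # vs) (t1 + t2)"

inductive_cases eval_elims:
  "eval P env (Var i) v t"
  "eval P env MkNil v t"
  "eval P env (MkCons e1 e2) v t"
  "eval P env (Hd e) v t"
  "eval P env (Tl e) v t"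
  "eval P env (Cond e e1 e2) v t"
  "eval P env (Call f es) v t"
  "evals P env [] vs t"
  "evals P env (e # es) vs t"

lemma eval_deterministic:
  "eval P env e v t \<Longrightarrow> eval P env e v' t' \<Longrightarrow> v' = v \<and> t' = t"
  "evals P env es vs t \<Longrightarrow> evals P env es vs' t' \<Longrightarrow> vs' = vs \<and> t' = t"
proof (induction arbitrary: v' t' and vs' t' rule: eval_evals.inducts)
  case (eval_Var i env)
  from eval_Var.prems show ?case
    by (rule eval_elims) simp
next
  case (eval_Nil env)
  from eval_Nil.prems show ?case
    by (rule eval_elims) simp
next
  case (eval_Cons env e1 v1 t1 e2 v2 t2)
  from eval_Cons.prems show ?case
    by (rule eval_elims) (auto dest: eval_Cons.IH(2,4))
next
  case (eval_Hd env e v t)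
  from eval_Hd.prems show ?case
    by (rule eval_elims) (auto dest: eval_Hd.IH(2))
next
  case (eval_Tl env e v t)
  from eval_Tl.prems show ?case
    by (rule eval_elims) (auto dest: eval_Tl.IH(2))
next
  case (eval_Cond_then env e v t e1 v1 t1 e2)
  from eval_Cond_then.prems show ?case
    by (rule eval_elims) (auto dest: eval_Cond_then.IH(2,4) simp: eval_Cond_then.hyps)
next
  case (eval_Cond_else env e t e2 v2 t2 e1)
  from eval_Cond_else.prems show ?case
    by (rule eval_elims) (auto dest: eval_Cond_else.IH(2,4))
next
  case (eval_Call env es vs t1 f v t2)
  from eval_Call.prems show ?case
    by (rule eval_elims) (auto dest: eval_Call.IH(2,5))
next
  case (evals_Nil env)
  from evals_Nil.prems show ?case
    by (rule eval_elims) simp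
next
  case (evals_Cons env e v t1 es vs t2)
  from evals_Cons.prems show ?case
    by (rule eval_elims) (auto dest: evals_Cons.IH(2,4))
qed

definition runs :: "program \<Rightarrow> sexp \<Rightarrow> sexp \<Rightarrow> nat \<Rightarrow> bool" where
  "runs P x v t \<longleftrightarrow> eval P [x] (Call 0 [Var 0]) v t"

text \<open>As for any truth value of the language, the answer \<open>SNil\<close> means no and every other answer
  means yes. The input size \<open>size (enc x)\<close> is the number of pairs of the encoding. The
  set \<open>D\<close> is the promise: nothing is required of the program on inputs outside of it.\<close>

definition decides_in_poly_time ::
  "program \<Rightarrow> ('i \<Rightarrow> sexp) \<Rightarrow> 'i set \<Rightarrow> ('i \<Rightarrow> bool) \<Rightarrow> bool" where
  "decides_in_poly_time P enc D Q \<longleftrightarrow>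
     (\<exists>p :: nat poly. \<forall>x \<in> D. \<exists>v t.
        runs P (enc x) v t \<and> t \<le> poly p (size (enc x)) \<and> (v \<noteq> SNil \<longleftrightarrow> Q x))"

section \<open>Encoding of the instances\<close>

text \<open>As usual, the vertices of an input graph are \<open>0, \<dots>, n - 1\<close>. The graph is given by its
  adjacency matrix and the two vertex sets by their characteristic vectors.\<close>

definition encode_list :: "sexp list \<Rightarrow> sexp" where
  "encode_list xs = foldr SCons xs SNil"

definition encode_bool :: "bool \<Rightarrow> sexp" where
  "encode_bool b = (if b then SCons SNil SNil else SNil)"

definition encode_set :: "nat \<Rightarrow> nat set \<Rightarrow> sexp" where
  "encode_set n A = encode_list (map (\<lambda>v. encode_bool (v \<in> A)) [0..<n])"

definition encode_graph :: "nat pair_pre_digraph \<Rightarrow> sexp" where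
  "encode_graph G = (let n = card (pverts G) in
     encode_list (map (\<lambda>u. encode_set n {v. (u, v) \<in> parcs G}) [0..<n]))"

type_synonym ts_instance = "nat pair_pre_digraph \<times> nat \<times> nat set \<times> nat set"

text \<open>The number \<open>k\<close> is not written down, since it is the number of ones of either vector.\<close>

fun encode_instance :: "ts_instance \<Rightarrow> sexp" where
  "encode_instance (G, k, I, J) =
     encode_list [encode_graph G,
       encode_set (card (pverts G)) I, encode_set (card (pverts G)) J]"

end

theory Submission
  imports Defs
begin

text \<open>Disjoint intervals are ordered from left to right, and sliding preserves the order of the tokens.
  Let \<open>R r\<close> be the set of the positions that the \<open>r\<close>-th token can reach. Parking a token at the position
  of \<open>R r\<close> whose right end is leftmost never obstructs the higher tokens, and dually. Hence all
  tokens can be parked leftmost at once, so the component is determined by the family \<open>R\<close>, and \<open>R\<close> is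
  the least family such that \<open>w \<in> R r\<close> whenever \<open>w\<close> is adjacent to some \<open>u \<in> R r\<close>, every \<open>R s\<close> with
  \<open>s < r\<close> has an element to the left of \<open>w\<close>, and every \<open>R s\<close> with \<open>s > r\<close> has one to the right.

  This characterization does not need the left-to-right order: it suffices to saturate a relation on
  pairs of token positions, in which a token only moves to a vertex non-adjacent to the other one, so
  that the order of the pair is inherited from the start. The saturation is a least fixed point of a
  first-order formula over the adjacency relation and the set of the tokens. Hence connectivity is
  definable in first-order logic with least fixed points, and every property definable in this logic
  is decidable in polynomial time.\<close>

definition apart :: "('a \<Rightarrow> 'a \<Rightarrow> bool) \<Rightarrow> 'a \<Rightarrow> 'a \<Rightarrow> bool" where
  "apart adj x y \<longleftrightarrow> x \<noteq> y \<and> \<not> adj x y"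

section \<open>Token sliding in interval orders\<close>

locale interval_order =
  fixes V :: "'a set" and prec :: "'a \<Rightarrow> 'a \<Rightarrow> bool" (infix "\<sqsubset>" 50)
  assumes finite_V: "finite V"
    and prec_in_V: "x \<sqsubset> y \<Longrightarrow> x \<in> V \<and> y \<in> V"
    and prec_irrefl: "\<not> x \<sqsubset> x"
    and prec_trans: "x \<sqsubset> y \<Longrightarrow> y \<sqsubset> z \<Longrightarrow> x \<sqsubset> z"
    and prec_cross: "a \<sqsubset> b \<Longrightarrow> c \<sqsubset> d \<Longrightarrow> a \<sqsubset> d \<or> c \<sqsubset> b"
begin

definition overlap :: "'a \<Rightarrow> 'a \<Rightarrow> bool" where
  "overlap x y \<longleftrightarrow> x \<in> V \<and> y \<in> V \<and> x \<noteq> y \<and> \<not> x \<sqsubset> y \<and> \<not> y \<sqsubset> x"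

lemma overlap_sym: "overlap x y \<Longrightarrow> overlap y x"
  by (auto simp: overlap_def)

lemma prec_imp_apart: "x \<sqsubset> y \<Longrightarrow> apart overlap x y" "x \<sqsubset> y \<Longrightarrow> apart overlap y x"
  using prec_irrefl by (auto simp: apart_def overlap_def)

lemma prec_overlap_trans: "x \<sqsubset> u \<Longrightarrow> overlap u w \<Longrightarrow> apart overlap x w \<Longrightarrow> x \<sqsubset> w"
  using prec_in_V prec_trans unfolding apart_def overlap_def by blast

lemma overlap_prec_trans: "u \<sqsubset> x \<Longrightarrow> overlap u w \<Longrightarrow> apart overlap x w \<Longrightarrow> w \<sqsubset> x"
  using prec_in_V prec_trans unfolding apart_def overlap_def by blast

text \<open>For intervals, \<open>leftmost X\<close> is the one whose right end is leftmost, and \<open>rightmost X\<close> the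
  one whose left end is rightmost.\<close>

definition leftmost :: "'a set \<Rightarrow> 'a" where
  "leftmost X = (SOME x. x \<in> X \<and> (\<forall>y\<in>X. \<forall>z. y \<sqsubset> z \<longrightarrow> x \<sqsubset> z))"

lemma ex_leftmost:
  assumes "finite X" "X \<noteq> {}"
  shows "\<exists>x. x \<in> X \<and> (\<forall>y\<in>X. \<forall>z. y \<sqsubset> z \<longrightarrow> x \<sqsubset> z)"
  using assms
proof (induction rule: finite_ne_induct)
  case (insert a F)
  then obtain x where "x \<in> F" "\<forall>y\<in>F. \<forall>z. y \<sqsubset> z \<longrightarrow> x \<sqsubset> z" by auto
  moreover have "(\<forall>z. x \<sqsubset> z \<longrightarrow> a \<sqsubset> z) \<or> (\<forall>z. a \<sqsubset> z \<longrightarrow> x \<sqsubset> z)"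
    using prec_cross by blast
  ultimately show ?case by blast
qed auto

lemma
  assumes "finite X" "X \<noteq> {}"
  shows leftmost_in: "leftmost X \<in> X"
    and leftmost_prec: "y \<in> X \<Longrightarrow> y \<sqsubset> z \<Longrightarrow> leftmost X \<sqsubset> z"
  using someI_ex[OF ex_leftmost[OF assms]] unfolding leftmost_def by blast+

interpretation dual: interval_order V "\<lambda>x y. y \<sqsubset> x"
  by unfold_locales (use finite_V prec_in_V prec_irrefl prec_trans prec_cross in blast)+

definition rightmost :: "'a set \<Rightarrow> 'a" where
  "rightmost = dual.leftmost"

lemmas rightmost_in = dual.leftmost_in[folded rightmost_def]
lemmas prec_rightmost = dual.leftmost_prec[folded rightmost_def]

definition configuration :: "nat \<Rightarrow> (nat \<Rightarrow> 'a) \<Rightarrow> bool" where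
  "configuration k c \<longleftrightarrow> (\<forall>r<k. c r \<in> V) \<and> (\<forall>s<k. \<forall>r<s. c r \<sqsubset> c s)"

definition slide :: "nat \<Rightarrow> (nat \<Rightarrow> 'a) \<Rightarrow> (nat \<Rightarrow> 'a) \<Rightarrow> bool" where
  "slide k c d \<longleftrightarrow> configuration k c \<and> configuration k d \<and>
     (\<exists>r<k. \<exists>w. overlap (c r) w \<and> d = c(r := w))"

abbreviation reaches :: "nat \<Rightarrow> (nat \<Rightarrow> 'a) \<Rightarrow> (nat \<Rightarrow> 'a) \<Rightarrow> bool" where
  "reaches k \<equiv> (slide k)\<^sup>*\<^sup>*"

lemma configuration_in_V: "configuration k c \<Longrightarrow> r < k \<Longrightarrow> c r \<in> V"
  by (simp add: configuration_def)

lemma configuration_prec: "configuration k c \<Longrightarrow> r < s \<Longrightarrow> s < k \<Longrightarrow> c r \<sqsubset> c s"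
  by (simp add: configuration_def)

lemma configuration_inj_on: "configuration k c \<Longrightarrow> inj_on c {..<k}"
  unfolding inj_on_def by (metis lessThan_iff linorder_neqE_nat prec_irrefl configuration_prec)

lemma configuration_apart:
  "configuration k c \<Longrightarrow> r < k \<Longrightarrow> s < k \<Longrightarrow> r \<noteq> s \<Longrightarrow> apart overlap (c r) (c s)"
  using configuration_prec prec_imp_apart by (metis linorder_neqE_nat)

lemma configuration_fun_upd:
  assumes "configuration k c" "r < k \<Longrightarrow> w \<in> V"
    and "\<And>s. s < r \<Longrightarrow> r < k \<Longrightarrow> c s \<sqsubset> w" "\<And>s. r < s \<Longrightarrow> s < k \<Longrightarrow> w \<sqsubset> c s"
  shows "configuration k (c(r := w))"
  using assms by (auto simp: configuration_def)

lemma slide_sym: "slide k c d \<Longrightarrow> slide k d c"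
  unfolding slide_def by (metis fun_upd_same fun_upd_triv fun_upd_upd overlap_sym)

lemma reaches_sym: "reaches k c d \<Longrightarrow> reaches k d c"
  by (metis slide_sym sympI symp_rtranclp sympD)

lemma reaches_configuration: "reaches k c d \<Longrightarrow> configuration k c \<Longrightarrow> configuration k d"
  by (induction rule: rtranclp_induct) (auto simp: slide_def)

definition positions :: "nat \<Rightarrow> (nat \<Rightarrow> 'a) \<Rightarrow> nat \<Rightarrow> 'a set" where
  "positions k c r = {d r | d. reaches k c d}"

lemma in_positions: "reaches k c d \<Longrightarrow> d r \<in> positions k c r"
  by (auto simp: positions_def)

lemma reaches_imp_positions_eq: "reaches k c d \<Longrightarrow> positions k c r = positions k d r"
  unfolding positions_def by (metis reaches_sym rtranclp_trans)

lemma finite_positions: "configuration k c \<Longrightarrow> r < k \<Longrightarrow> finite (positions k c r)"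
  by (rule finite_subset[OF _ finite_V])
    (auto simp: positions_def intro: configuration_in_V reaches_configuration)

lemma positions_nonempty: "positions k c r \<noteq> {}"
  using in_positions[OF rtranclp.rtrancl_refl] by blast

definition spread :: "nat \<Rightarrow> (nat \<Rightarrow> 'a) \<Rightarrow> nat \<Rightarrow> nat \<Rightarrow> 'a" where
  "spread k c a r = (if r < a then leftmost (positions k c r) else rightmost (positions k c r))"

lemma spread_in_positions: "configuration k c \<Longrightarrow> r < k \<Longrightarrow> spread k c a r \<in> positions k c r"
  by (simp add: spread_def leftmost_in rightmost_in finite_positions positions_nonempty)

lemma spread_prec:
  "configuration k c \<Longrightarrow> r < a \<Longrightarrow> r < k \<Longrightarrow> u \<in> positions k c r \<Longrightarrow> u \<sqsubset> w \<Longrightarrow> spread k c a r \<sqsubset> w"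
  by (simp add: spread_def leftmost_prec[OF finite_positions positions_nonempty])

lemma prec_spread:
  "configuration k c \<Longrightarrow> a \<le> r \<Longrightarrow> r < k \<Longrightarrow> u \<in> positions k c r \<Longrightarrow> w \<sqsubset> u \<Longrightarrow> w \<sqsubset> spread k c a r"
  by (simp add: spread_def prec_rightmost[OF finite_positions positions_nonempty])

definition pinnable :: "nat \<Rightarrow> (nat \<Rightarrow> 'a) \<Rightarrow> nat set \<Rightarrow> (nat \<Rightarrow> 'a) \<Rightarrow> bool" where
  "pinnable k c A f \<longleftrightarrow> (\<forall>d. reaches k c d \<longrightarrow> reaches k c (override_on d f A))"

lemma slide_override_on:
  assumes "slide k c d" "configuration k (override_on c f A)" "configuration k (override_on d f A)"
  shows "reaches k (override_on c f A) (override_on d f A)"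
proof -
  obtain r w where "r < k" "overlap (c r) w" and d: "d = c(r := w)"
    using assms(1) by (auto simp: slide_def)
  show ?thesis
  proof (cases "r \<in> A")
    case True
    then have "override_on d f A = override_on c f A" by (auto simp: d override_on_def)
    then show ?thesis by simp
  next
    case False
    then have "override_on d f A = (override_on c f A)(r := w)" by (auto simp: d override_on_def)
    moreover have "overlap (override_on c f A r) w" using False \<open>overlap (c r) w\<close> by simp
    ultimately have "slide k (override_on c f A) (override_on d f A)"
      using assms(2,3) \<open>r < k\<close> unfolding slide_def by blast
    then show ?thesis by blast
  qed
qed

lemma reaches_override_on:
  assumes "reaches k c d" and "\<And>e. reaches k c e \<Longrightarrow> configuration k (override_on e f A)"
  shows "reaches k (override_on c f A) (override_on d f A)"
  using assms(1)
proof (induction rule: rtranclp_induct)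
  case (step d e)
  then have "reaches k (override_on d f A) (override_on e f A)"
    by (intro slide_override_on assms(2)) auto
  then show ?case using step.IH by (rule rtranclp_trans[rotated])
qed simp

lemma pinnable_insert:
  assumes conf: "configuration k c" and pinnable: "pinnable k c A f"
    and "r \<notin> A" "f r \<in> positions k c r"
    and left: "\<And>d s. reaches k c d \<Longrightarrow> s \<notin> A \<Longrightarrow> s < r \<Longrightarrow> r < k \<Longrightarrow> d s \<sqsubset> f r"
    and right: "\<And>d s. reaches k c d \<Longrightarrow> s \<notin> A \<Longrightarrow> r < s \<Longrightarrow> s < k \<Longrightarrow> f r \<sqsubset> d s"
  shows "pinnable k c (insert r A) f"
  unfolding pinnable_def
proof (intro allI impI)
  fix d assume reaches_d: "reaches k c d"
  obtain e where reaches_e: "reaches k c e" and "e r = f r"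
    using \<open>f r \<in> positions k c r\<close> by (auto simp: positions_def)
  have conf_A: "configuration k (override_on x f A)" if "reaches k c x" for x
    using that pinnable conf reaches_configuration unfolding pinnable_def by blast
  have "configuration k (override_on x f (insert r A))" if reaches_x: "reaches k c x" for x
    unfolding override_on_insert
  proof (rule configuration_fun_upd[OF conf_A[OF reaches_x]])
    show "override_on x f A s \<sqsubset> f r" if "s < r" "r < k" for s
      using configuration_prec[OF conf_A[OF reaches_e] that] left[OF reaches_x _ that]
        \<open>r \<notin> A\<close> \<open>e r = f r\<close> by (cases "s \<in> A") auto
    show "f r \<sqsubset> override_on x f A s" if "r < s" "s < k" for s
      using configuration_prec[OF conf_A[OF reaches_e] that] right[OF reaches_x _ that]
        \<open>r \<notin> A\<close> \<open>e r = f r\<close> by (cases "s \<in> A") auto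
    show "f r \<in> V" if "r < k"
      using configuration_in_V[OF reaches_configuration[OF reaches_e conf] that] \<open>e r = f r\<close> by simp
  qed
  then have "reaches k (override_on e f (insert r A)) (override_on d f (insert r A))"
    using reaches_e reaches_d by (intro reaches_override_on) (meson reaches_sym rtranclp_trans)+
  moreover have "override_on e f (insert r A) = override_on e f A"
    using \<open>e r = f r\<close> by (auto simp: override_on_def)
  moreover have "reaches k c (override_on e f A)"
    using pinnable reaches_e by (simp add: pinnable_def)
  ultimately show "reaches k c (override_on d f (insert r A))" by simp
qed

lemma reaches_prec:
  assumes "configuration k c" "reaches k c d" "r < s" "s < k"
  shows "d r \<sqsubset> d s"
  using configuration_prec[OF reaches_configuration[OF assms(2,1)] assms(3,4)] .

lemma pinnable_spread_lessThan:
  assumes conf: "configuration k c" and "b \<le> a" "a \<le> k"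
  shows "pinnable k c {..<b} (spread k c a)"
  using \<open>b \<le> a\<close>
proof (induction b)
  case 0
  then show ?case by (simp add: pinnable_def)
next
  case (Suc b)
  have "pinnable k c (insert b {..<b}) (spread k c a)"
  proof (rule pinnable_insert[OF conf])
    show "spread k c a b \<in> positions k c b"
      using Suc.prems \<open>a \<le> k\<close> by (simp add: spread_in_positions[OF conf])
    show "spread k c a b \<sqsubset> d s" if "reaches k c d" "b < s" "s < k" for d s
      using Suc.prems that
      by (intro spread_prec[OF conf _ _ in_positions reaches_prec[OF conf]]) auto
  qed (use Suc in auto)
  then show ?case by (simp add: lessThan_Suc)
qed

lemma pinnable_spread:
  assumes conf: "configuration k c" and "a \<le> b" "b \<le> k"
  shows "pinnable k c ({..<a} \<union> {b..<k}) (spread k c a)"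
  using \<open>b \<le> k\<close> \<open>a \<le> b\<close>
proof (induction rule: inc_induct)
  case base
  then show ?case using pinnable_spread_lessThan[OF conf order.refl] by simp
next
  case (step b)
  have "pinnable k c (insert b ({..<a} \<union> {Suc b..<k})) (spread k c a)"
  proof (rule pinnable_insert[OF conf])
    show "spread k c a b \<in> positions k c b"
      using step.hyps by (simp add: spread_in_positions[OF conf])
    show "d s \<sqsubset> spread k c a b" if "reaches k c d" "s < b" "b < k" for d s
      using step.prems that
      by (intro prec_spread[OF conf _ _ in_positions reaches_prec[OF conf]]) auto
  qed (use step in auto)
  moreover have "insert b ({..<a} \<union> {Suc b..<k}) = {..<a} \<union> {b..<k}"
    using step.hyps by auto
  ultimately show ?case by simp
qed

lemma reaches_leftmost:
  assumes "configuration k c"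
  obtains d where "reaches k c d" "\<And>r. r < k \<Longrightarrow> d r = leftmost (positions k c r)"
proof
  show "reaches k c (override_on c (spread k c k) {..<k})"
    using pinnable_spread[OF assms, of k k] by (simp add: pinnable_def)
qed (simp add: spread_def)

text \<open>The lower tokens make way by moving to their leftmost and the higher ones by moving to their
  rightmost positions.\<close>

lemma positions_step:
  assumes conf: "configuration k c" and "r < k" "u \<in> positions k c r" "overlap u w"
    and left: "\<And>s. s < r \<Longrightarrow> \<exists>x\<in>positions k c s. x \<sqsubset> w"
    and right: "\<And>s. r < s \<Longrightarrow> s < k \<Longrightarrow> \<exists>x\<in>positions k c s. w \<sqsubset> x"
  shows "w \<in> positions k c r"
proof -
  obtain d where "reaches k c d" "d r = u" using \<open>u \<in> positions k c r\<close> by (auto simp: positions_def)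
  define e where "e = override_on d (spread k c r) ({..<r} \<union> {Suc r..<k})"
  have reaches_e: "reaches k c e"
    using pinnable_spread[OF conf, of r "Suc r"] \<open>r < k\<close> \<open>reaches k c d\<close>
    by (simp add: pinnable_def e_def)
  then have "configuration k e" using conf by (rule reaches_configuration)
  moreover have "configuration k (e(r := w))"
  proof (rule configuration_fun_upd[OF \<open>configuration k e\<close>])
    show "w \<in> V" using \<open>overlap u w\<close> by (simp add: overlap_def)
    show "e s \<sqsubset> w" if "s < r" for s
      using left[OF that] spread_prec[OF conf that] that \<open>r < k\<close> by (auto simp: e_def)
    show "w \<sqsubset> e s" if "r < s" "s < k" for s
      using right[OF that] prec_spread[OF conf less_imp_le] that by (auto simp: e_def)
  qed
  moreover have "e r = u" using \<open>d r = u\<close> by (simp add: e_def)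
  ultimately have "slide k e (e(r := w))"
    using \<open>r < k\<close> \<open>overlap u w\<close> unfolding slide_def by blast
  with reaches_e have "reaches k c (e(r := w))" by simp
  from in_positions[OF this, of r] show ?thesis by simp
qed

end

section \<open>The pair closure\<close>

text \<open>A tuple \<open>(i, u, j, w)\<close> asserts that the tokens starting at \<open>i\<close> and \<open>j\<close> can reach \<open>u\<close> and \<open>w\<close>,
  respectively, and that \<open>u\<close> and \<open>w\<close> are in the same left-to-right order as \<open>i\<close> and \<open>j\<close>. It need not be
  possible to have both tokens there at the same time.\<close>

inductive_set pair_closure :: "('a \<Rightarrow> 'a \<Rightarrow> bool) \<Rightarrow> 'a set \<Rightarrow> ('a \<times> 'a \<times> 'a \<times> 'a) set"
  for adj :: "'a \<Rightarrow> 'a \<Rightarrow> bool" and I :: "'a set" where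
  start: "i \<in> I \<Longrightarrow> j \<in> I \<Longrightarrow> (i, i, j, j) \<in> pair_closure adj I"
| swap: "(j, w, i, u) \<in> pair_closure adj I \<Longrightarrow> (i, u, j, w) \<in> pair_closure adj I"
| move: "(i, u, j, w) \<in> pair_closure adj I \<Longrightarrow> adj u u' \<Longrightarrow>
    \<forall>l\<in>I - {i}. \<exists>x. (i, u, l, x) \<in> pair_closure adj I \<and> apart adj x u' \<Longrightarrow>
    i = j \<and> w' = u' \<or> i \<noteq> j \<and> w' = w \<and> apart adj w u' \<Longrightarrow>
    (i, u', j, w') \<in> pair_closure adj I"

definition token_range :: "('a \<Rightarrow> 'a \<Rightarrow> bool) \<Rightarrow> 'a set \<Rightarrow> 'a \<Rightarrow> 'a set" where
  "token_range adj I i = {u. (i, u, i, u) \<in> pair_closure adj I}"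

context interval_order
begin

definition position_pairs :: "nat \<Rightarrow> (nat \<Rightarrow> 'a) \<Rightarrow> ('a \<times> 'a \<times> 'a \<times> 'a) set" where
  "position_pairs k c = {(c r, u, c s, w) | r u s w. r < k \<and> s < k \<and>
     u \<in> positions k c r \<and> w \<in> positions k c s \<and>
     (r = s \<longrightarrow> u = w) \<and> (r < s \<longrightarrow> u \<sqsubset> w) \<and> (s < r \<longrightarrow> w \<sqsubset> u)}"

lemma position_pairs_iff:
  assumes "configuration k c" "r < k" "s < k"
  shows "(c r, u, c s, w) \<in> position_pairs k c \<longleftrightarrow>
    u \<in> positions k c r \<and> w \<in> positions k c s \<and>
    (r = s \<longrightarrow> u = w) \<and> (r < s \<longrightarrow> u \<sqsubset> w) \<and> (s < r \<longrightarrow> w \<sqsubset> u)"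
proof
  assume "(c r, u, c s, w) \<in> position_pairs k c"
  then obtain r' s' where "c r = c r'" "c s = c s'" "r' < k" "s' < k"
    and pair: "u \<in> positions k c r'" "w \<in> positions k c s'"
      "(r' = s' \<longrightarrow> u = w) \<and> (r' < s' \<longrightarrow> u \<sqsubset> w) \<and> (s' < r' \<longrightarrow> w \<sqsubset> u)"
    unfolding position_pairs_def by blast
  then have "r' = r" "s' = s"
    using assms(2,3) inj_on_eq_iff[OF configuration_inj_on[OF assms(1)]] by auto
  with pair show "u \<in> positions k c r \<and> w \<in> positions k c s \<and>
      (r = s \<longrightarrow> u = w) \<and> (r < s \<longrightarrow> u \<sqsubset> w) \<and> (s < r \<longrightarrow> w \<sqsubset> u)"
    by simp
qed (use assms(2,3) in \<open>auto simp: position_pairs_def\<close>)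

lemma position_pairs_step:
  assumes conf: "configuration k c" and "r < k" "u \<in> positions k c r" "overlap u u'"
    and unblocked: "\<And>s. s < k \<Longrightarrow> s \<noteq> r \<Longrightarrow>
      \<exists>x. (c r, u, c s, x) \<in> position_pairs k c \<and> apart overlap x u'"
  shows "u' \<in> positions k c r"
proof (rule positions_step[OF assms(1-4)])
  note pair = position_pairs_iff[OF conf \<open>r < k\<close>]
  show "\<exists>x\<in>positions k c s. x \<sqsubset> u'" if "s < r" for s
    using unblocked[of s] prec_overlap_trans[OF _ \<open>overlap u u'\<close>] pair[of s] that \<open>r < k\<close> by auto
  show "\<exists>x\<in>positions k c s. u' \<sqsubset> x" if "r < s" "s < k" for s
    using unblocked[of s] overlap_prec_trans[OF _ \<open>overlap u u'\<close>] pair[of s] that by auto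
qed

lemma pair_closure_imp_position_pairs:
  assumes conf: "configuration k c" and "(i, u, j, w) \<in> pair_closure overlap (c ` {..<k})"
  shows "(i, u, j, w) \<in> position_pairs k c"
  using assms(2)
proof (induction rule: pair_closure.induct)
  case (start i j)
  then obtain r s where "r < k" "s < k" "i = c r" "j = c s" by blast
  then show ?case
    using configuration_prec[OF conf] in_positions[OF rtranclp.rtrancl_refl]
    by (simp add: position_pairs_iff[OF conf])
next
  case (swap j w i u)
  then show ?case unfolding position_pairs_def by blast
next
  case (move i u j w u' w')
  then obtain r s where "r < k" "i = c r" and "s < k" "j = c s"
    unfolding position_pairs_def by blast
  note token_eq_iff = inj_on_eq_iff[OF configuration_inj_on[OF conf]]
  have pair: "u \<in> positions k c r" "w \<in> positions k c s"
    "r < s \<longrightarrow> u \<sqsubset> w" "s < r \<longrightarrow> w \<sqsubset> u"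
    using move.IH(1) \<open>r < k\<close> \<open>i = c r\<close> \<open>s < k\<close> \<open>j = c s\<close>
    by (simp_all add: position_pairs_iff[OF conf])
  have "u' \<in> positions k c r"
  proof (rule position_pairs_step[OF conf \<open>r < k\<close> pair(1) \<open>overlap u u'\<close>])
    fix t assume "t < k" "t \<noteq> r"
    then have "c t \<in> c ` {..<k} - {i}" using token_eq_iff \<open>r < k\<close> \<open>i = c r\<close> by auto
    then show "\<exists>x. (c r, u, c t, x) \<in> position_pairs k c \<and> apart overlap x u'"
      using move.IH(2) \<open>i = c r\<close> by blast
  qed
  moreover have "u' \<sqsubset> w" if "r < s" "apart overlap w u'"
    using overlap_prec_trans \<open>overlap u u'\<close> pair(3) that by blast
  moreover have "w \<sqsubset> u'" if "s < r" "apart overlap w u'"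
    using prec_overlap_trans \<open>overlap u u'\<close> pair(4) that by blast
  moreover have "c r = c s \<longleftrightarrow> r = s" using token_eq_iff \<open>r < k\<close> \<open>s < k\<close> by simp
  ultimately show ?case
    using move.hyps pair(2) \<open>r < k\<close> \<open>i = c r\<close> \<open>s < k\<close> \<open>j = c s\<close>
    by (auto simp: position_pairs_iff[OF conf])
qed

lemma pair_closure_complete:
  assumes conf: "configuration k c" and "reaches k c d" and "r < k" "s < k"
  shows "(c r, d r, c s, d s) \<in> pair_closure overlap (c ` {..<k})"
  using assms(2-)
proof (induction arbitrary: r s rule: rtranclp_induct)
  case base
  then show ?case by (intro pair_closure.start) auto
next
  case (step d e)
  then obtain t w where "t < k" "overlap (d t) w" and e: "e = d(t := w)"
    and "configuration k e" by (auto simp: slide_def)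
  have apart: "apart overlap (d s) w" if "s < k" "s \<noteq> t" for s
    using configuration_apart[OF \<open>configuration k e\<close> that(1) \<open>t < k\<close> that(2)] that by (simp add: e)
  have unblocked: "\<forall>l\<in>c ` {..<k} - {c t}.
      \<exists>x. (c t, d t, l, x) \<in> pair_closure overlap (c ` {..<k}) \<and> apart overlap x w"
    using step.IH[OF \<open>t < k\<close>] apart by blast
  have moved: "(c t, e t, c s, e s) \<in> pair_closure overlap (c ` {..<k})" if "s < k" for s
  proof (rule pair_closure.move[OF step.IH[OF \<open>t < k\<close> that]])
    show "c t = c s \<and> e s = e t \<or> c t \<noteq> c s \<and> e s = d s \<and> apart overlap (d s) (e t)"
      using apart that inj_on_eq_iff[OF configuration_inj_on[OF conf]] \<open>t < k\<close> by (auto simp: e)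
  qed (use \<open>overlap (d t) w\<close> unblocked in \<open>simp_all add: e\<close>)
  consider (first) "r = t" | (second) "s = t" | (neither) "r \<noteq> t" "s \<noteq> t" by blast
  then show ?case
  proof cases
    case first
    then show ?thesis using moved[OF step.prems(2)] by simp
  next
    case second
    then show ?thesis using pair_closure.swap[OF moved[OF step.prems(1)]] by simp
  next
    case neither
    then show ?thesis using step.IH[OF step.prems] by (simp add: e)
  qed
qed

lemma token_range_eq_positions:
  assumes "configuration k c" "r < k"
  shows "token_range overlap (c ` {..<k}) (c r) = positions k c r"
proof (intro equalityI subsetI)
  fix u assume "u \<in> token_range overlap (c ` {..<k}) (c r)"
  then have "(c r, u, c r, u) \<in> position_pairs k c"
    by (intro pair_closure_imp_position_pairs[OF assms(1)]) (simp add: token_range_def)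
  then show "u \<in> positions k c r" by (simp add: position_pairs_iff[OF assms(1,2,2)])
next
  fix u assume "u \<in> positions k c r"
  then show "u \<in> token_range overlap (c ` {..<k}) (c r)"
    using pair_closure_complete[OF assms(1) _ assms(2,2)]
    by (auto simp: token_range_def positions_def)
qed

end

section \<open>Interval graphs\<close>

lemma is_interval_disjoint_iff:
  fixes S T :: "real set"
  assumes "is_interval S" "is_interval T"
  shows "S \<inter> T = {} \<longleftrightarrow> (\<forall>x\<in>S. \<forall>y\<in>T. x < y) \<or> (\<forall>x\<in>T. \<forall>y\<in>S. x < y)"
proof (intro iffI, rule ccontr)
  assume disjoint: "S \<inter> T = {}"
    and "\<not> ((\<forall>x\<in>S. \<forall>y\<in>T. x < y) \<or> (\<forall>x\<in>T. \<forall>y\<in>S. x < y))"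
  then obtain x x' y y' where in_S: "x \<in> S" "x' \<in> S" and in_T: "y \<in> T" "y' \<in> T"
    and "y \<le> x" "x' \<le> y'" by (meson not_le)
  consider (inside_S) "y' \<le> x" | (inside_T) "x \<le> y'" by linarith
  then show False
  proof cases
    case inside_S
    then have "y' \<in> S" using assms(1) in_S \<open>x' \<le> y'\<close> unfolding is_interval_1 by blast
    then show False using in_T disjoint by blast
  next
    case inside_T
    then have "x \<in> T" using assms(2) in_T \<open>y \<le> x\<close> unfolding is_interval_1 by blast
    then show False using in_S disjoint by blast
  qed
qed force

definition left_of :: "'a set \<Rightarrow> ('a \<Rightarrow> 'b::linorder set) \<Rightarrow> 'a \<Rightarrow> 'a \<Rightarrow> bool" where
  "left_of V S u v \<longleftrightarrow> u \<in> V \<and> v \<in> V \<and> (\<forall>x\<in>S u. \<forall>y\<in>S v. x < y)"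

lemma interval_order_left_of:
  assumes "finite V" and nonempty: "\<And>v. v \<in> V \<Longrightarrow> S v \<noteq> {}"
  shows "interval_order V (left_of V S)"
proof
  show "\<not> left_of V S x x" for x using nonempty unfolding left_of_def by blast
  show "left_of V S x z" if "left_of V S x y" "left_of V S y z" for x y z
    using that nonempty unfolding left_of_def by (meson ex_in_conv less_trans)
  show "left_of V S a d \<or> left_of V S c b" if left_of: "left_of V S a b" "left_of V S c d"
    for a b c d
  proof (rule ccontr)
    assume "\<not> ?thesis"
    then obtain x y x' y' where "x \<in> S a" "y \<in> S d" "y \<le> x" "x' \<in> S c" "y' \<in> S b" "y' \<le> x'"
      using left_of unfolding left_of_def by (meson not_le)
    moreover from this have "x < y'" "x' < y" using left_of unfolding left_of_def by blast+
    ultimately show False by order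
  qed
qed (use \<open>finite V\<close> in \<open>auto simp: left_of_def\<close>)

locale interval_ordered_graph = pair_graph G + interval_order "pverts G" prec
  for G :: "'a pair_pre_digraph" and prec :: "'a \<Rightarrow> 'a \<Rightarrow> bool" (infix "\<sqsubset>" 50) +
  assumes parcs_iff: "(u, v) \<in> parcs G \<longleftrightarrow> overlap u v"

lemma interval_graph_imp_ordered:
  assumes "interval_graph G"
  obtains prec where "interval_ordered_graph G prec"
proof -
  obtain S :: "'a \<Rightarrow> real set" where "pair_graph G"
    and intervals: "\<forall>v\<in>pverts G. is_interval (S v) \<and> S v \<noteq> {}"
    and arcs: "\<forall>u\<in>pverts G. \<forall>v\<in>pverts G. u \<noteq> v \<longrightarrow> ((u, v) \<in> parcs G \<longleftrightarrow> S u \<inter> S v \<noteq> {})"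
    using assms unfolding interval_graph_def by (elim conjE exE)
  interpret pair_graph G by fact
  interpret interval_order "pverts G" "left_of (pverts G) S"
    using intervals by (intro interval_order_left_of) auto
  have "(u, v) \<in> parcs G \<longleftrightarrow> overlap u v" for u v
  proof (cases "u \<in> pverts G \<and> v \<in> pverts G \<and> u \<noteq> v")
    case True
    then show ?thesis
      using arcs intervals is_interval_disjoint_iff[of "S u" "S v"]
      by (auto simp: overlap_def left_of_def)
  next
    case False
    then show ?thesis
      using wellformed[of "(u, v)"] pair_no_loops[of "(u, v)"] by (auto simp: overlap_def)
  qed
  then have "interval_ordered_graph G (left_of (pverts G) S)" by unfold_locales
  then show ?thesis by (rule that)
qed

lemma same_component_iff_reachable:
  assumes "pair_graph H"
  shows "same_component H x y \<longleftrightarrow> x \<rightarrow>\<^sup>*\<^bsub>with_proj H\<^esub> y"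
proof
  interpret pair_graph H by fact
  show "x \<rightarrow>\<^sup>*\<^bsub>with_proj H\<^esub> y" if "same_component H x y"
    using that by (auto simp: same_component_def in_sccs_verts_conv_reachable)
  assume reachable: "x \<rightarrow>\<^sup>*\<^bsub>with_proj H\<^esub> y"
  then have "y \<in> pverts H" using reachable_in_verts by fastforce
  then show "same_component H x y"
    using scc_of_in_sccs_verts[of y] in_scc_of_self[of y] scc_ofI_reachable[OF reachable]
    unfolding same_component_def by auto
qed

context interval_ordered_graph
begin

lemma configuration_independent:
  assumes "configuration k c"
  shows "c ` {..<k} \<in> independent_sets G k"
proof -
  have "card (c ` {..<k}) = k" using configuration_inj_on[OF assms] by (simp add: card_image)
  moreover have "\<not> overlap (c r) (c s)" if "r < k" "s < k" for r s
    using configuration_apart[OF assms that] by (cases "r = s") (auto simp: apart_def overlap_def)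
  ultimately show ?thesis
    using configuration_in_V[OF assms] by (auto simp: independent_sets_def parcs_iff)
qed

lemma independent_configuration:
  assumes "I \<in> independent_sets G k"
  obtains c where "configuration k c" "c ` {..<k} = I"
  using assms
proof (induction k arbitrary: I thesis)
  case 0
  then have "I = {}"
    using finite_V by (auto simp: independent_sets_def dest: finite_subset)
  then show ?case using 0(1)[of undefined] by (simp add: configuration_def)
next
  case (Suc k)
  have "I \<subseteq> pverts G" "card I = Suc k"
    and independent: "\<And>u v. u \<in> I \<Longrightarrow> v \<in> I \<Longrightarrow> \<not> overlap u v"
    using Suc.prems(2) by (auto simp: independent_sets_def parcs_iff)
  then have "finite I" "I \<noteq> {}" by (auto intro: card_ge_0_finite)
  define x where "x = rightmost I"
  have "x \<in> I" and before_x: "\<And>y z. y \<in> I \<Longrightarrow> z \<sqsubset> y \<Longrightarrow> z \<sqsubset> x"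
    using rightmost_in prec_rightmost \<open>finite I\<close> \<open>I \<noteq> {}\<close> unfolding x_def by blast+
  have prec_x: "y \<sqsubset> x" if "y \<in> I - {x}" for y
    using that \<open>x \<in> I\<close> before_x independent[of y x] \<open>I \<subseteq> pverts G\<close> prec_irrefl
    by (auto simp: overlap_def)
  have "I - {x} \<in> independent_sets G k"
    using Suc.prems(2) \<open>x \<in> I\<close> \<open>finite I\<close> by (auto simp: independent_sets_def)
  then obtain c where c: "configuration k c" "c ` {..<k} = I - {x}" using Suc.IH by blast
  have "configuration (Suc k) (c(k := x))"
    using c prec_x \<open>x \<in> I\<close> \<open>I \<subseteq> pverts G\<close> by (auto simp: configuration_def less_Suc_eq)
  moreover have "(c(k := x)) ` {..<Suc k} = I"
    using c(2) \<open>x \<in> I\<close> by (auto simp: lessThan_Suc image_iff)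
  ultimately show ?case by (rule Suc.prems(1))
qed

lemma configuration_fun_upd_image:
  assumes "configuration k c" "r < k"
  shows "(c(r := w)) ` {..<k} = insert w (c ` {..<k} - {c r})"
  using configuration_inj_on[OF assms(1)] assms(2) by (auto simp: inj_on_def image_iff)

lemma slide_imp_arc:
  assumes "slide k c d"
  shows "(c ` {..<k}, d ` {..<k}) \<in> parcs (TS k G)"
proof -
  obtain r w where conf_c: "configuration k c" and conf_d: "configuration k d"
    and "r < k" "overlap (c r) w" and d: "d = c(r := w)"
    using assms by (auto simp: slide_def)
  have independent: "c ` {..<k} \<in> independent_sets G k"
    using conf_c by (rule configuration_independent)
  then have "w \<notin> c ` {..<k}"
    using \<open>r < k\<close> \<open>overlap (c r) w\<close> by (auto simp: independent_sets_def parcs_iff)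
  then have "c ` {..<k} - d ` {..<k} = {c r}" "d ` {..<k} - c ` {..<k} = {w}"
    using configuration_fun_upd_image[OF conf_c \<open>r < k\<close>, of w] \<open>r < k\<close> d by auto
  then show ?thesis
    using independent configuration_independent[OF conf_d] overlap_sym[OF \<open>overlap (c r) w\<close>]
    by (auto simp: TS_def parcs_iff)
qed

lemma arc_imp_slide:
  assumes "(c ` {..<k}, J) \<in> parcs (TS k G)" and conf: "configuration k c"
  obtains d where "slide k c d" "d ` {..<k} = J"
proof -
  obtain u v where left: "c ` {..<k} - J = {v}" and entered: "J - c ` {..<k} = {u}"
    and "overlap u v" and independent: "J \<in> independent_sets G k"
    using assms(1) by (auto simp: TS_def parcs_iff)
  have "v \<in> c ` {..<k}" using left by blast
  then obtain r where "r < k" "c r = v" by blast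
  have "J = insert u (c ` {..<k} - {v})" using left entered by blast
  then have image: "(c(r := u)) ` {..<k} = J"
    using configuration_fun_upd_image[OF conf \<open>r < k\<close>] \<open>c r = v\<close> by simp
  have overlap: "overlap (c r) u" using \<open>overlap u v\<close> overlap_sym \<open>c r = v\<close> by simp
  have apart: "apart overlap (c s) u" if "s < k" "s \<noteq> r" for s
  proof -
    have "c s \<in> J" unfolding image[symmetric] using that by force
    moreover have "u \<in> J" using entered by blast
    ultimately have "\<not> overlap (c s) u"
      using independent by (auto simp: independent_sets_def parcs_iff)
    moreover have "c s \<noteq> u" using that entered by auto
    ultimately show ?thesis by (simp add: apart_def)
  qed
  have "configuration k (c(r := u))"
  proof (rule configuration_fun_upd[OF conf])
    show "u \<in> pverts G" using overlap by (simp add: overlap_def)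
    show "c s \<sqsubset> u" if "s < r" for s
      using prec_overlap_trans[OF configuration_prec[OF conf that \<open>r < k\<close>] overlap]
        apart that \<open>r < k\<close> by simp
    show "u \<sqsubset> c s" if "r < s" "s < k" for s
      using overlap_prec_trans[OF configuration_prec[OF conf that] overlap] apart that by simp
  qed
  then have "slide k c (c(r := u))" using conf \<open>r < k\<close> overlap unfolding slide_def by blast
  then show ?thesis using image that by blast
qed

lemma same_component_iff_reaches:
  assumes conf: "configuration k c"
  shows "same_component (TS k G) (c ` {..<k}) J \<longleftrightarrow> (\<exists>d. reaches k c d \<and> d ` {..<k} = J)"
proof -
  interpret TS: pair_graph "TS k G" using pair_graph_TS[OF pair_graph_axioms] .
  have "(c ` {..<k}) \<rightarrow>\<^sup>*\<^bsub>with_proj (TS k G)\<^esub> (d ` {..<k})" if "reaches k c d" for d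
    using that
  proof (induction rule: rtranclp_induct)
    case base
    then show ?case
      using configuration_independent[OF conf] by (intro TS.reachable_refl) (simp add: TS_def)
  next
    case (step d e)
    then show ?case using slide_imp_arc[OF step(2)] TS.reachable_adj_trans by auto
  qed
  moreover have "\<exists>d. reaches k c d \<and> d ` {..<k} = J"
    if "(c ` {..<k}) \<rightarrow>\<^sup>*\<^bsub>with_proj (TS k G)\<^esub> J"
    using that
  proof (induction rule: TS.reachable_induct)
    case base
    then show ?case by blast
  next
    case (step J K)
    then obtain d where "reaches k c d" "d ` {..<k} = J" by blast
    then have "(d ` {..<k}, K) \<in> parcs (TS k G)" using step(2) by simp
    then obtain e where "slide k d e" "e ` {..<k} = K"
      using arc_imp_slide[OF _ reaches_configuration[OF \<open>reaches k c d\<close> conf]] by blast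
    then show ?case using rtranclp.rtrancl_into_rtrancl[OF \<open>reaches k c d\<close>] by blast
  qed
  ultimately show ?thesis
    unfolding same_component_iff_reachable[OF TS.pair_graph_axioms] by blast
qed

definition leftmost_set :: "nat \<Rightarrow> (nat \<Rightarrow> 'a) \<Rightarrow> 'a set" where
  "leftmost_set k c = (\<lambda>r. leftmost (positions k c r)) ` {..<k}"

lemma
  assumes conf: "configuration k c"
  shows same_component_leftmost_set: "same_component (TS k G) (c ` {..<k}) (leftmost_set k c)"
    and card_leftmost_set: "card (leftmost_set k c) = k"
proof -
  obtain d where reaches: "reaches k c d" and "\<And>r. r < k \<Longrightarrow> d r = leftmost (positions k c r)"
    using reaches_leftmost[OF conf] by blast
  then have image: "d ` {..<k} = leftmost_set k c"
    unfolding leftmost_set_def by (intro image_cong) auto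
  then show "same_component (TS k G) (c ` {..<k}) (leftmost_set k c)"
    using reaches by (auto simp: same_component_iff_reaches[OF conf])
  show "card (leftmost_set k c) = k"
    unfolding image[symmetric]
    using configuration_inj_on[OF reaches_configuration[OF reaches conf]] by (simp add: card_image)
qed

lemma positions_eq_imp_same_component:
  assumes conf_c: "configuration k c" and conf_d: "configuration k d"
    and positions: "\<And>r. r < k \<Longrightarrow> \<exists>s<k. positions k c r = positions k d s"
  shows "same_component (TS k G) (c ` {..<k}) (d ` {..<k})"
proof -
  have "leftmost_set k c \<subseteq> leftmost_set k d" using positions by (force simp: leftmost_set_def)
  then have leftmost_eq: "leftmost_set k c = leftmost_set k d"
    using card_leftmost_set conf_c conf_d by (intro card_subset_eq) (auto simp: leftmost_set_def)
  interpret TS: pair_graph "TS k G" using pair_graph_TS[OF pair_graph_axioms] .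
  show ?thesis
    using same_component_leftmost_set[OF conf_c] same_component_leftmost_set[OF conf_d]
    unfolding same_component_iff_reachable[OF TS.pair_graph_axioms] leftmost_eq
    by (rule TS.reachable_trans[OF _ TS.symmetric_reachable'])
qed

theorem same_component_iff_token_ranges:
  assumes "I \<in> independent_sets G k" "J \<in> independent_sets G k"
  defines "R \<equiv> token_range (\<lambda>u v. (u, v) \<in> parcs G)"
  shows "same_component (TS k G) I J \<longleftrightarrow> (\<forall>i\<in>I. \<exists>j\<in>J. R I i = R J j)"
proof -
  have R_eq: "R (c ` {..<k}) (c r) = positions k c r" if "configuration k c" "r < k" for c r
    using token_range_eq_positions[OF that] unfolding R_def parcs_iff .
  obtain c where conf_c: "configuration k c" and image_c: "c ` {..<k} = I"
    by (rule independent_configuration[OF assms(1)])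
  obtain d where conf_d: "configuration k d" and image_d: "d ` {..<k} = J"
    by (rule independent_configuration[OF assms(2)])
  show ?thesis
  proof
    assume "same_component (TS k G) I J"
    then obtain e where reaches: "reaches k c e" and image_e: "e ` {..<k} = J"
      using same_component_iff_reaches[OF conf_c, of J] image_c by blast
    have "R I (c r) = R J (e r)" if "r < k" for r
      using R_eq[OF conf_c that] R_eq[OF reaches_configuration[OF reaches conf_c] that]
        reaches_imp_positions_eq[OF reaches, of r] image_c image_e by simp
    then show "\<forall>i\<in>I. \<exists>j\<in>J. R I i = R J j"
      unfolding image_c[symmetric] image_e[symmetric] by auto
  next
    assume ranges: "\<forall>i\<in>I. \<exists>j\<in>J. R I i = R J j"
    have "\<exists>s<k. positions k c r = positions k d s" if "r < k" for r
    proof -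
      have "c r \<in> I" using image_c that by blast
      then obtain j where "j \<in> J" "R I (c r) = R J j" using ranges by blast
      moreover from \<open>j \<in> J\<close> obtain s where "s < k" "j = d s" using image_d by blast
      ultimately have "positions k c r = positions k d s"
        using R_eq[OF conf_c that] R_eq[OF conf_d] image_c image_d by simp
      then show ?thesis using \<open>s < k\<close> by blast
    qed
    from positions_eq_imp_same_component[OF conf_c conf_d this]
    show "same_component (TS k G) I J" unfolding image_c image_d .
  qed
qed

end

section \<open>Running times of expressions\<close>

definition eval_within :: "program \<Rightarrow> sexp list \<Rightarrow> expr \<Rightarrow> sexp \<Rightarrow> nat \<Rightarrow> bool" where
  "eval_within P env e v T \<longleftrightarrow> (\<exists>t\<le>T. eval P env e v t)"

definition evals_within :: "program \<Rightarrow> sexp list \<Rightarrow> expr list \<Rightarrow> sexp list \<Rightarrow> nat \<Rightarrow> bool" where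
  "evals_within P env es vs T \<longleftrightarrow> (\<exists>t\<le>T. evals P env es vs t)"

definition computes_within :: "program \<Rightarrow> nat \<Rightarrow> sexp list \<Rightarrow> sexp \<Rightarrow> nat \<Rightarrow> bool" where
  "computes_within P f vs v T \<longleftrightarrow> f < length P \<and> eval_within P vs (P ! f) v T"

lemma eval_within_mono: "eval_within P env e v T \<Longrightarrow> T \<le> T' \<Longrightarrow> eval_within P env e v T'"
  unfolding eval_within_def by (meson order_trans)

lemma computes_within_mono:
  "computes_within P f vs v T \<Longrightarrow> T \<le> T' \<Longrightarrow> computes_within P f vs v T'"
  unfolding computes_within_def using eval_within_mono by blast

lemma eval_within_MkCons:
  "eval_within P env a v S \<Longrightarrow> eval_within P env b w T \<Longrightarrow>
    eval_within P env (MkCons a b) (SCons v w) (S + T + 1)"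
  unfolding eval_within_def by (meson add_le_mono eval_Cons order_refl)

lemma eval_within_Cond:
  assumes "eval_within P env e v S"
    and "v \<noteq> SNil \<Longrightarrow> eval_within P env a w T" "v = SNil \<Longrightarrow> eval_within P env b w T"
  shows "eval_within P env (Cond e a b) w (S + T + 1)"
  using assms unfolding eval_within_def
  by (metis add_le_mono eval_Cond_then eval_Cond_else order_refl)

lemma eval_within_Call:
  "evals_within P env es vs S \<Longrightarrow> computes_within P f vs v T \<Longrightarrow>
    eval_within P env (Call f es) v (S + T + 1)"
  unfolding computes_within_def eval_within_def evals_within_def
  by (meson add_le_mono eval_Call order_refl)

lemma evals_within_Nil: "evals_within P env [] [] 0"
  unfolding evals_within_def by (blast intro: evals_Nil)

lemma evals_within_Cons:
  "eval_within P env e v S \<Longrightarrow> evals_within P env es vs T \<Longrightarrow>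
    evals_within P env (e # es) (v # vs) (S + T)"
  unfolding eval_within_def evals_within_def by (meson add_le_mono evals_Cons)

fun straight :: "nat \<Rightarrow> expr \<Rightarrow> bool" where
  "straight m (Var i) \<longleftrightarrow> i < m"
| "straight m MkNil \<longleftrightarrow> True"
| "straight m (MkCons a b) \<longleftrightarrow> straight m a \<and> straight m b"
| "straight m (Hd e) \<longleftrightarrow> straight m e"
| "straight m (Tl e) \<longleftrightarrow> straight m e"
| "straight m (Cond e a b) \<longleftrightarrow> False"
| "straight m (Call f es) \<longleftrightarrow> False"

fun straight_value :: "sexp list \<Rightarrow> expr \<Rightarrow> sexp" where
  "straight_value env (Var i) = env ! i"
| "straight_value env (MkCons a b) = SCons (straight_value env a) (straight_value env b)"
| "straight_value env (Hd e) = shd (straight_value env e)"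
| "straight_value env (Tl e) = stl (straight_value env e)"
| "straight_value env e = SNil"

fun straight_time :: "expr \<Rightarrow> nat" where
  "straight_time (MkCons a b) = straight_time a + straight_time b + 1"
| "straight_time (Hd e) = straight_time e + 1"
| "straight_time (Tl e) = straight_time e + 1"
| "straight_time e = 1"

lemma eval_straight:
  "straight (length env) e \<Longrightarrow> eval P env e (straight_value env e) (straight_time e)"
proof (induction e)
  case (Var i)
  then show ?case using eval_Var[of i env P] by simp
next
  case MkNil
  then show ?case using eval_Nil[of P env] by simp
qed (auto intro: eval_Cons eval_Hd eval_Tl simp del: One_nat_def add_Suc_right)

lemma eval_within_straight:
  "straight (length env) e \<Longrightarrow> straight_value env e = v \<Longrightarrow>
    eval_within P env e v (straight_time e)"
  unfolding eval_within_def using eval_straight by blast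

lemma evals_within_straight:
  "list_all (straight (length env)) es \<Longrightarrow> map (straight_value env) es = vs \<Longrightarrow>
    evals_within P env es vs (\<Sum>e\<leftarrow>es. straight_time e)"
  by (induction es arbitrary: vs)
    (auto simp: evals_within_Nil evals_within_Cons eval_within_straight)

lemma eval_within_Call_straight:
  assumes "computes_within P f vs v T" "list_all (straight (length env)) es"
    "map (straight_value env) es = vs"
  shows "eval_within P env (Call f es) v ((\<Sum>e\<leftarrow>es. straight_time e) + T + 1)"
  using eval_within_Call[OF evals_within_straight] assms by blast

lemma eval_within_Cond_then:
  assumes "eval_within P env a v T" "straight (length env) e" "straight_value env e \<noteq> SNil"
  shows "eval_within P env (Cond e a b) v (straight_time e + T + 1)"
  using eval_within_Cond[OF eval_within_straight[OF assms(2) refl]] assms by blast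

lemma eval_within_Cond_else:
  assumes "eval_within P env b v T" "straight (length env) e" "straight_value env e = SNil"
  shows "eval_within P env (Cond e a b) v (straight_time e + T + 1)"
  using eval_within_Cond[OF eval_within_straight[OF assms(2) refl]] assms by blast

definition true_expr :: expr where
  "true_expr = MkCons MkNil MkNil"

definition not_expr :: "expr \<Rightarrow> expr" where
  "not_expr e = Cond e MkNil true_expr"

definition and_expr :: "expr \<Rightarrow> expr \<Rightarrow> expr" where
  "and_expr a b = Cond a b MkNil"

definition or_expr :: "expr \<Rightarrow> expr \<Rightarrow> expr" where
  "or_expr a b = Cond a true_expr b"

lemma encode_bool_eq_SNil [simp]: "encode_bool b = SNil \<longleftrightarrow> \<not> b"
  by (simp add: encode_bool_def)

lemma eval_within_true: "eval_within P env true_expr (encode_bool True) 3"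
  by (rule eval_within_mono[OF eval_within_straight]) (simp_all add: true_expr_def encode_bool_def)

lemma eval_within_false: "eval_within P env MkNil (encode_bool False) 1"
  by (rule eval_within_mono[OF eval_within_straight]) (simp_all add: encode_bool_def)

lemma eval_within_not:
  assumes "eval_within P env e (encode_bool a) T"
  shows "eval_within P env (not_expr e) (encode_bool (\<not> a)) (T + 4)"
  unfolding not_expr_def
  by (rule eval_within_mono[OF eval_within_Cond[OF assms, where T = 3]])
    (auto intro: eval_within_mono[OF eval_within_true] eval_within_mono[OF eval_within_false])

lemma eval_within_and:
  assumes "eval_within P env e (encode_bool a) S" "a \<Longrightarrow> eval_within P env e' (encode_bool b) T"
  shows "eval_within P env (and_expr e e') (encode_bool (a \<and> b)) (S + T + 2)"
  unfolding and_expr_def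
  by (rule eval_within_mono[OF eval_within_Cond[OF assms(1), where T = "T + 1"]])
    (use eval_within_mono[OF assms(2)] eval_within_mono[OF eval_within_false] in auto)

lemma eval_within_or:
  assumes "eval_within P env e (encode_bool a) S" "\<not> a \<Longrightarrow> eval_within P env e' (encode_bool b) T"
  shows "eval_within P env (or_expr e e') (encode_bool (a \<or> b)) (S + T + 4)"
  unfolding or_expr_def
  by (rule eval_within_mono[OF eval_within_Cond[OF assms(1), where T = "T + 3"]])
    (use eval_within_mono[OF assms(2)] eval_within_mono[OF eval_within_true] in auto)

primrec constant_expr :: "sexp \<Rightarrow> expr" where
  "constant_expr SNil = MkNil"
| "constant_expr (SCons a b) = MkCons (constant_expr a) (constant_expr b)"

lemma eval_within_constant: "eval_within P env (constant_expr x) x (2 * size x + 1)"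
proof (rule eval_within_mono[OF eval_within_straight])
  show "straight (length env) (constant_expr x)" by (induction x) simp_all
  show "straight_value env (constant_expr x) = x" by (induction x) simp_all
  show "straight_time (constant_expr x) \<le> 2 * size x + 1" by (induction x) simp_all
qed

section \<open>Numbers and tables\<close>

text \<open>Any value stands for the number of pairs along its spine. In particular, a value of spine \<open>n\<close> can
  serve as a universe whose elements \<open>0, \<dots>, n - 1\<close> are its proper tails.\<close>

primrec spine :: "sexp \<Rightarrow> nat" where
  "spine SNil = 0"
| "spine (SCons a b) = Suc (spine b)"

lemma spine_eq_0_iff: "spine x = 0 \<longleftrightarrow> x = SNil"
  by (cases x) simp_all

lemma spine_stl: "spine (stl x) = spine x - 1"
  by (cases x) simp_all

lemma spine_le_size: "spine x \<le> size x"
  by (induction x) simp_all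

lemma encode_list_simps [simp]:
  "encode_list [] = SNil" "encode_list (x # xs) = SCons x (encode_list xs)"
  by (simp_all add: encode_list_def)

lemma spine_encode_list [simp]: "spine (encode_list xs) = length xs"
  by (induction xs) simp_all

lemma size_encode_list: "size (encode_list xs) = (\<Sum>x\<leftarrow>xs. Suc (size x))"
  by (induction xs) simp_all

definition encode_nat :: "nat \<Rightarrow> sexp" where
  "encode_nat k = encode_list (replicate k SNil)"

lemma spine_encode_nat [simp]: "spine (encode_nat k) = k"
  by (simp add: encode_nat_def)

primrec sexp_nth :: "sexp \<Rightarrow> nat \<Rightarrow> sexp" where
  "sexp_nth x 0 = shd x"
| "sexp_nth x (Suc k) = sexp_nth (stl x) k"

lemma sexp_nth_encode_list: "k < length xs \<Longrightarrow> sexp_nth (encode_list xs) k = xs ! k"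
  by (induction xs arbitrary: k) (auto simp: less_Suc_eq_0_disj)

abbreviation lookup :: "sexp \<Rightarrow> nat list \<Rightarrow> sexp" where
  "lookup \<equiv> foldl sexp_nth"

definition tuples :: "nat \<Rightarrow> nat \<Rightarrow> nat list set" where
  "tuples n m = {ws. set ws \<subseteq> {..<n} \<and> length ws = m}"

definition represents :: "nat \<Rightarrow> nat \<Rightarrow> sexp \<Rightarrow> nat list set \<Rightarrow> bool" where
  "represents n m x R \<longleftrightarrow> (\<forall>ws\<in>tuples n m. lookup x ws = encode_bool (ws \<in> R))"

primrec tabulate :: "nat \<Rightarrow> nat \<Rightarrow> (nat list \<Rightarrow> sexp) \<Rightarrow> sexp" where
  "tabulate n 0 f = f []"
| "tabulate n (Suc m) f = encode_list (map (\<lambda>v. tabulate n m (\<lambda>ws. f (v # ws))) [0..<n])"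

lemma lookup_tabulate: "ws \<in> tuples n m \<Longrightarrow> lookup (tabulate n m f) ws = f ws"
proof (induction m arbitrary: f ws)
  case 0
  then show ?case by (simp add: tuples_def)
next
  case (Suc m)
  then obtain v us where "ws = v # us" "v < n" "us \<in> tuples n m"
    by (cases ws) (auto simp: tuples_def)
  then show ?case by (simp add: sexp_nth_encode_list Suc.IH)
qed

lemma size_tabulate_ge: "n ^ m \<le> Suc (size (tabulate n m f))"
proof (induction m arbitrary: f)
  case (Suc m)
  have "n ^ Suc m = (\<Sum>v\<leftarrow>[0..<n]. n ^ m)" by (simp add: sum_list_triv)
  also have "\<dots> \<le> (\<Sum>v\<leftarrow>[0..<n]. Suc (size (tabulate n m (\<lambda>ws. f (v # ws)))))"
    by (intro sum_list_mono Suc.IH)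
  finally show ?case by (simp add: size_encode_list comp_def)
qed simp

lemma size_tabulate_le:
  assumes "\<And>ws. size (f ws) \<le> 1"
  shows "Suc (size (tabulate n m f)) \<le> 2 * Suc n ^ m"
  using assms
proof (induction m arbitrary: f)
  case (Suc m)
  have "size (tabulate n (Suc m) f) = (\<Sum>v\<leftarrow>[0..<n]. Suc (size (tabulate n m (\<lambda>ws. f (v # ws)))))"
    by (simp add: size_encode_list comp_def)
  also have "\<dots> \<le> (\<Sum>v\<leftarrow>[0..<n]. 2 * Suc n ^ m)"
    by (intro sum_list_mono Suc)
  also have "\<dots> = 2 * n * Suc n ^ m" by (simp add: sum_list_triv)
  also have "Suc \<dots> \<le> 2 * n * Suc n ^ m + 2 * Suc n ^ m" by simp
  finally show ?case by (simp add: algebra_simps)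
qed (simp add: le_Suc_eq)

section \<open>First-order logic with least fixed points\<close>

text \<open>Variables are de Bruijn indices. Inside of \<open>Lfp m \<phi> ks\<close>, the \<open>m\<close>-ary relation that is being
  defined has the index \<open>0\<close>, and so has the last component of its argument tuple. As \<^const>\<open>lfp\<close> is
  only a fixed point for monotone operators, monotonicity is part of well-formedness.\<close>

datatype formula =
    Equal nat nat
  | Atom nat "nat list"
  | Neg formula
  | Conj formula formula
  | Exists formula
  | Lfp nat formula "nat list"

primrec holds :: "nat \<Rightarrow> nat list set list \<Rightarrow> nat list \<Rightarrow> formula \<Rightarrow> bool" where
  "holds n S vs (Equal i j) \<longleftrightarrow> vs ! i = vs ! j"
| "holds n S vs (Atom r ks) \<longleftrightarrow> map ((!) vs) ks \<in> S ! r"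
| "holds n S vs (Neg \<phi>) \<longleftrightarrow> \<not> holds n S vs \<phi>"
| "holds n S vs (Conj \<phi> \<psi>) \<longleftrightarrow> holds n S vs \<phi> \<and> holds n S vs \<psi>"
| "holds n S vs (Exists \<phi>) \<longleftrightarrow> (\<exists>v<n. holds n S (v # vs) \<phi>)"
| "holds n S vs (Lfp m \<phi> ks) \<longleftrightarrow>
     map ((!) vs) ks \<in> lfp (\<lambda>X. {ws \<in> tuples n m. holds n (X # S) (rev ws @ vs) \<phi>})"

definition stage ::
    "nat \<Rightarrow> nat list set list \<Rightarrow> nat list \<Rightarrow> nat \<Rightarrow> formula \<Rightarrow> nat list set \<Rightarrow> nat list set" where
  "stage n S vs m \<phi> X = {ws \<in> tuples n m. holds n (X # S) (rev ws @ vs) \<phi>}"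

primrec well_formed :: "nat list \<Rightarrow> nat \<Rightarrow> formula \<Rightarrow> bool" where
  "well_formed ars l (Equal i j) \<longleftrightarrow> i < l \<and> j < l"
| "well_formed ars l (Atom r ks) \<longleftrightarrow> r < length ars \<and> length ks = ars ! r \<and> set ks \<subseteq> {..<l}"
| "well_formed ars l (Neg \<phi>) \<longleftrightarrow> well_formed ars l \<phi>"
| "well_formed ars l (Conj \<phi> \<psi>) \<longleftrightarrow> well_formed ars l \<phi> \<and> well_formed ars l \<psi>"
| "well_formed ars l (Exists \<phi>) \<longleftrightarrow> well_formed ars (Suc l) \<phi>"
| "well_formed ars l (Lfp m \<phi> ks) \<longleftrightarrow> well_formed (m # ars) (m + l) \<phi> \<and>
     length ks = m \<and> set ks \<subseteq> {..<l} \<and> (\<forall>n S vs. mono (stage n S vs m \<phi>))"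

lemma holds_Lfp: "holds n S vs (Lfp m \<phi> ks) \<longleftrightarrow> map ((!) vs) ks \<in> lfp (stage n S vs m \<phi>)"
  by (simp add: stage_def[abs_def])

lemma funpow_eq_lfp:
  fixes F :: "'a set \<Rightarrow> 'a set"
  assumes "mono F" and bounded: "\<And>X. F X \<subseteq> U" and "finite U" "card U \<le> k"
  shows "(F ^^ k) {} = lfp F"
proof -
  define f where "f k = (F ^^ k) {}" for k
  have f_Suc: "f (Suc k) = F (f k)" for k by (simp add: f_def)
  have f_subset: "f k \<subseteq> U" for k using bounded by (cases k) (auto simp: f_def)
  have "f k \<subseteq> f (Suc k)" for k
    unfolding f_def using funpow_mono2[OF \<open>mono F\<close>, of k "Suc k" "{}" "{}"] by simp
  then have "mono f" by (simp add: mono_iff_le_Suc)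
  have "finite (range f)"
    by (rule finite_subset[of _ "Pow U"]) (use f_subset \<open>finite U\<close> in auto)
  then have "f (card U) = (\<Union>k. f k)"
    using \<open>mono f\<close> f_subset \<open>finite U\<close> by (intro finite_mono_strict_prefix_implies_finite_fixpoint
        finite_mono_remains_stable_implies_strict_prefix) (auto simp: f_Suc)
  then have "f k = (\<Union>k. f k)" "f (Suc k) = (\<Union>k. f k)"
    using monoD[OF \<open>mono f\<close>, of "card U"] \<open>card U \<le> k\<close> le_SucI by blast+
  then show ?thesis using lfp_Kleene_iter[OF \<open>mono F\<close>, of k] by (simp add: f_def)
qed

lemma finite_tuples: "finite (tuples n m)"
  unfolding tuples_def by (rule finite_lists_length_eq) simp

lemma card_tuples: "card (tuples n m) = n ^ m"
  unfolding tuples_def using card_lists_length_eq[of "{..<n}" m] by simp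

lemma funpow_stage_eq_lfp:
  assumes "mono (stage n S vs m \<phi>)" "n ^ m \<le> k"
  shows "(stage n S vs m \<phi> ^^ k) {} = lfp (stage n S vs m \<phi>)"
  by (rule funpow_eq_lfp[OF assms(1) _ finite_tuples])
    (use assms(2) in \<open>auto simp: stage_def card_tuples\<close>)

section \<open>An interpreter for formulas\<close>

primrec encode_formula :: "formula \<Rightarrow> sexp" where
  "encode_formula (Equal i j) = SCons (encode_nat 0) (SCons (encode_nat i) (encode_nat j))"
| "encode_formula (Atom r ks) =
     SCons (encode_nat 1) (SCons (encode_nat r) (encode_list (map encode_nat ks)))"
| "encode_formula (Neg \<phi>) = SCons (encode_nat 2) (encode_formula \<phi>)"
| "encode_formula (Conj \<phi> \<psi>) = SCons (encode_nat 3) (SCons (encode_formula \<phi>) (encode_formula \<psi>))"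
| "encode_formula (Exists \<phi>) = SCons (encode_nat 4) (encode_formula \<phi>)"
| "encode_formula (Lfp m \<phi> ks) = SCons (encode_nat 5)
     (SCons (encode_nat m) (SCons (encode_formula \<phi>) (encode_list (map encode_nat ks))))"

primrec switch_expr :: "expr list \<Rightarrow> expr \<Rightarrow> expr" where
  "switch_expr [] e = MkNil"
| "switch_expr (b # bs) e = Cond e (switch_expr bs (Tl e)) b"

lemma eval_within_switch:
  assumes "straight (length env) e" "spine (straight_value env e) = k" "k < length bs"
    and "eval_within P env (bs ! k) v T"
  shows "eval_within P env (switch_expr bs e) v (T + (straight_time e + k + 1) * Suc k)"
  using assms
proof (induction bs arbitrary: e k)
  case (Cons b bs)
  show ?case
  proof (cases k)
    case 0
    then show ?thesis
      using Cons.prems unfolding switch_expr.simps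
      by (intro eval_within_mono[OF eval_within_Cond_else[where T = T]])
        (simp_all add: spine_eq_0_iff)
  next
    case (Suc l)
    then have "eval_within P env (switch_expr bs (Tl e)) v
        (T + (straight_time (Tl e) + l + 1) * Suc l)"
      using Cons.prems by (intro Cons.IH) (simp_all add: spine_stl)
    moreover have "straight_value env e \<noteq> SNil" using Cons.prems(2) Suc by auto
    ultimately have "eval_within P env (switch_expr (b # bs) e) v
        (straight_time e + (T + (straight_time (Tl e) + l + 1) * Suc l) + 1)"
      using Cons.prems(1) unfolding switch_expr.simps by (intro eval_within_Cond_then)
    then show ?thesis by (rule eval_within_mono) (simp add: Suc)
  qed
qed simp

abbreviation (input) "EVAL \<equiv> 1 :: nat"
abbreviation (input) "EXISTS \<equiv> 2 :: nat"
abbreviation (input) "TABULATE \<equiv> 3 :: nat"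
abbreviation (input) "ROW \<equiv> 4 :: nat"
abbreviation (input) "ITERATE \<equiv> 5 :: nat"
abbreviation (input) "LOOKUP \<equiv> 6 :: nat"
abbreviation (input) "NTH \<equiv> 7 :: nat"
abbreviation (input) "EQUAL \<equiv> 8 :: nat"

text \<open>The parameters of \<open>EVAL\<close>, and hence of its branches, are the formula, the assignment, the tables
  and the universe. For the other functions, comments name the parameters.\<close>

definition equal_branch :: expr where
  "equal_branch = Call EQUAL [Call NTH [Var 1, Hd (Tl (Var 0))], Call NTH [Var 1, Tl (Tl (Var 0))]]"

definition atom_branch :: expr where
  "atom_branch = Call LOOKUP [Call NTH [Var 2, Hd (Tl (Var 0))], Tl (Tl (Var 0)), Var 1]"

definition neg_branch :: expr where
  "neg_branch = not_expr (Call EVAL [Tl (Var 0), Var 1, Var 2, Var 3])"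

definition conj_branch :: expr where
  "conj_branch = and_expr (Call EVAL [Hd (Tl (Var 0)), Var 1, Var 2, Var 3])
     (Call EVAL [Tl (Tl (Var 0)), Var 1, Var 2, Var 3])"

definition exists_branch :: expr where
  "exists_branch = Call EXISTS [Var 3, Tl (Var 0), Var 1, Var 2, Var 3]"

text \<open>\<open>ITERATE\<close> performs one step for every leaf of its counter; any table of arity \<open>m\<close> has enough
  leaves to reach the fixed point.\<close>

definition fixpoint_expr :: expr where
  "fixpoint_expr = (let m = Hd (Tl (Var 0)); \<phi> = Hd (Tl (Tl (Var 0))) in
     Call ITERATE
       [Call TABULATE [m, \<phi>, Var 1, MkCons MkNil (Var 2), Var 3],
        MkNil, m, \<phi>, Var 1, Var 2, Var 3])"

definition lfp_branch :: expr where
  "lfp_branch = Call LOOKUP [fixpoint_expr, Tl (Tl (Tl (Var 0))), Var 1]"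

definition eval_branches :: "expr list" where
  "eval_branches = [equal_branch, atom_branch, neg_branch, conj_branch, exists_branch, lfp_branch]"

lemma eval_branches_nth:
  "eval_branches ! 0 = equal_branch" "eval_branches ! 1 = atom_branch"
  "eval_branches ! 2 = neg_branch" "eval_branches ! 3 = conj_branch"
  "eval_branches ! 4 = exists_branch" "eval_branches ! 5 = lfp_branch"
  by (simp_all add: eval_branches_def)

definition eval_body :: expr where
  "eval_body = switch_expr eval_branches (Hd (Var 0))"

definition exists_body :: expr where \<comment> \<open>remaining universe, formula, assignment, tables, universe\<close>
  "exists_body = Cond (Var 0)
     (or_expr (Call EVAL [Var 1, MkCons (Tl (Var 0)) (Var 2), Var 3, Var 4])
       (Call EXISTS [Tl (Var 0), Var 1, Var 2, Var 3, Var 4]))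
     MkNil"

definition tabulate_body :: expr where \<comment> \<open>arity, formula, assignment, tables, universe\<close>
  "tabulate_body = Cond (Var 0)
     (Call ROW [Var 4, MkNil, Tl (Var 0), Var 1, Var 2, Var 3, Var 4])
     (Call EVAL [Var 1, Var 2, Var 3, Var 4])"

definition row_body :: expr where
  \<comment> \<open>remaining universe, accumulator, arity, formula, assignment, tables, universe\<close>
  "row_body = Cond (Var 0)
     (Call ROW [Tl (Var 0),
        MkCons (Call TABULATE [Var 2, Var 3, MkCons (Tl (Var 0)) (Var 4), Var 5, Var 6]) (Var 1),
        Var 2, Var 3, Var 4, Var 5, Var 6])
     (Var 1)"

definition iterate_body :: expr where
  \<comment> \<open>counter, current table, arity, formula, assignment, tables, universe\<close>
  "iterate_body = Cond (Var 0)
     (Call ITERATE [Tl (Var 0),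
        Call ITERATE [Hd (Var 0), Var 1, Var 2, Var 3, Var 4, Var 5, Var 6],
        Var 2, Var 3, Var 4, Var 5, Var 6])
     (Call TABULATE [Var 2, Var 3, Var 4, MkCons (Var 1) (Var 5), Var 6])"

definition lookup_body :: expr where \<comment> \<open>table, variables, assignment\<close>
  "lookup_body = Cond (Var 1)
     (Call LOOKUP [Call NTH [Var 0, Call NTH [Var 2, Hd (Var 1)]], Tl (Var 1), Var 2])
     (Var 0)"

definition nth_body :: expr where \<comment> \<open>list, index\<close>
  "nth_body = Cond (Var 1) (Call NTH [Tl (Var 0), Tl (Var 1)]) (Hd (Var 0))"

definition equal_body :: expr where
  "equal_body = Cond (Var 0)
     (Cond (Var 1) (Call EQUAL [Tl (Var 0), Tl (Var 1)]) MkNil)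
     (not_expr (Var 1))"

definition interpreter :: "expr \<Rightarrow> program" where
  "interpreter main = [main, eval_body, exists_body, tabulate_body, row_body, iterate_body,
     lookup_body, nth_body, equal_body]"

context
  fixes main :: expr
begin

abbreviation computes :: "nat \<Rightarrow> sexp list \<Rightarrow> sexp \<Rightarrow> nat \<Rightarrow> bool" where
  "computes \<equiv> computes_within (interpreter main)"

lemma computesI:
  "eval_within (interpreter main) vs eval_body v S \<Longrightarrow> S \<le> T \<Longrightarrow> computes EVAL vs v T"
  "eval_within (interpreter main) vs exists_body v S \<Longrightarrow> S \<le> T \<Longrightarrow> computes EXISTS vs v T"
  "eval_within (interpreter main) vs tabulate_body v S \<Longrightarrow> S \<le> T \<Longrightarrow> computes TABULATE vs v T"
  "eval_within (interpreter main) vs row_body v S \<Longrightarrow> S \<le> T \<Longrightarrow> computes ROW vs v T"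
  "eval_within (interpreter main) vs iterate_body v S \<Longrightarrow> S \<le> T \<Longrightarrow> computes ITERATE vs v T"
  "eval_within (interpreter main) vs lookup_body v S \<Longrightarrow> S \<le> T \<Longrightarrow> computes LOOKUP vs v T"
  "eval_within (interpreter main) vs nth_body v S \<Longrightarrow> S \<le> T \<Longrightarrow> computes NTH vs v T"
  "eval_within (interpreter main) vs equal_body v S \<Longrightarrow> S \<le> T \<Longrightarrow> computes EQUAL vs v T"
  by (simp_all add: computes_within_def interpreter_def eval_within_mono)

lemma computes_nth: "computes NTH [x, i] (sexp_nth x (spine i)) (10 * spine i + 10)"
proof (induction i arbitrary: x)
  case SNil
  show ?case
    by (rule computesI, unfold nth_body_def)
      (rule eval_within_Cond_else[OF eval_within_straight], simp_all)
next
  case (SCons a i)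
  show ?case
    by (rule computesI, unfold nth_body_def spine.simps sexp_nth.simps)
      (rule eval_within_Cond_then[OF eval_within_Call_straight[OF SCons.IH(2)[of "stl x"]]],
        simp_all)
qed

lemma computes_nth_encode_list:
  "k < length xs \<Longrightarrow> computes NTH [encode_list xs, encode_nat k] (xs ! k) (10 * k + 10)"
  using computes_nth[of "encode_list xs" "encode_nat k"] by (simp add: sexp_nth_encode_list)

lemma computes_equal:
  "computes EQUAL [x, y] (encode_bool (spine x = spine y)) (10 * spine x + 20)"
proof (induction x arbitrary: y)
  case SNil
  have var: "eval_within (interpreter main) [SNil, y] (Var 1) y 1"
    by (rule eval_within_mono[OF eval_within_straight]) simp_all
  have body: "eval_within (interpreter main) [SNil, y] (not_expr (Var 1))
      (encode_bool (spine y = 0)) 5"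
    unfolding not_expr_def spine_eq_0_iff
    by (rule eval_within_mono[OF eval_within_Cond[OF var, where T = 3]])
      (use eval_within_true eval_within_mono[OF eval_within_false] in auto)
  show ?case
    by (rule computesI, unfold equal_body_def spine.simps eq_commute[of 0])
      (rule eval_within_Cond_else[OF body], simp_all)
next
  case (SCons a x)
  have "eval_within (interpreter main) [SCons a x, y]
      (Cond (Var 1) (Call EQUAL [Tl (Var 0), Tl (Var 1)]) MkNil)
      (encode_bool (Suc (spine x) = spine y)) (10 * spine x + 27)"
  proof (cases y)
    case SNil
    show ?thesis
      by (rule eval_within_mono[OF eval_within_Cond_else[OF eval_within_straight]])
        (simp_all add: SNil encode_bool_def)
  next
    case y: (SCons b z)
    show ?thesis
      unfolding y spine.simps nat.inject
      by (rule eval_within_mono[OF eval_within_Cond_then[OF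
              eval_within_Call_straight[OF SCons.IH(2)]]]) simp_all
  qed
  note body = eval_within_Cond_then[OF this]
  show ?case
    by (rule computesI, unfold equal_body_def spine.simps) (rule body, simp_all)
qed

lemma computes_lookup:
  assumes "\<And>i. i \<in> set ks \<Longrightarrow> i < length xs" and bounded: "\<And>x. x \<in> set xs \<Longrightarrow> spine x < n"
  shows "computes LOOKUP [x, encode_list (map encode_nat ks), encode_list xs]
    (lookup x (map (\<lambda>i. spine (xs ! i)) ks)) (10 * sum_list ks + (10 * n + 50) * length ks + 10)"
  using assms(1)
proof (induction ks arbitrary: x)
  case Nil
  show ?case
    by (rule computesI, unfold lookup_body_def)
      (rule eval_within_Cond_else[OF eval_within_straight], simp_all)
next
  case (Cons i ks)
  let ?env = "[x, encode_list (encode_nat i # map encode_nat ks), encode_list xs]"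
  let ?v = "xs ! i"
  have "i < length xs" "spine ?v < n" using Cons.prems bounded by simp_all
  have var: "eval_within (interpreter main) ?env (Call NTH [Var 2, Hd (Var 1)]) ?v (10 * i + 14)"
    by (rule eval_within_mono[OF eval_within_Call_straight
          [OF computes_nth_encode_list[OF \<open>i < length xs\<close>]]]) simp_all
  have "evals_within (interpreter main) ?env [Var 0, Call NTH [Var 2, Hd (Var 1)]] [x, ?v]
      (1 + (10 * i + 14 + 0))"
    by (intro evals_within_Cons evals_within_Nil var eval_within_mono[OF eval_within_straight])
      simp_all
  from eval_within_Call[OF this computes_nth]
  have entry: "eval_within (interpreter main) ?env
      (Call NTH [Var 0, Call NTH [Var 2, Hd (Var 1)]]) (sexp_nth x (spine ?v))
      (10 * i + 10 * n + 26)"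
    by (rule eval_within_mono) (use \<open>spine ?v < n\<close> in simp)
  have "evals_within (interpreter main) ?env
      [Call NTH [Var 0, Call NTH [Var 2, Hd (Var 1)]], Tl (Var 1), Var 2]
      [sexp_nth x (spine ?v), encode_list (map encode_nat ks), encode_list xs]
      (10 * i + 10 * n + 26 + (2 + (1 + 0)))"
    by (intro evals_within_Cons evals_within_Nil entry eval_within_mono[OF eval_within_straight])
      simp_all
  note body = eval_within_Cond_then[OF eval_within_Call[OF this Cons.IH]]
  show ?case
    by (rule computesI, unfold lookup_body_def list.map foldl_Cons)
      (rule body, use Cons.prems in \<open>simp_all add: algebra_simps\<close>)
qed

lemma computes_exists:
  assumes "\<And>x. spine x < spine r \<Longrightarrow>
    computes EVAL [\<phi>, SCons x xs, ts, u] (encode_bool (Q (spine x))) T"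
  shows "computes EXISTS [r, \<phi>, xs, ts, u] (encode_bool (\<exists>v<spine r. Q v))
    ((T + 30) * Suc (spine r))"
  using assms
proof (induction r)
  case SNil
  show ?case
    by (rule computesI, unfold exists_body_def)
      (rule eval_within_Cond_else[OF eval_within_straight], simp_all add: encode_bool_def)
next
  case (SCons a r)
  have rest: "computes EXISTS [r, \<phi>, xs, ts, u] (encode_bool (\<exists>v<spine r. Q v))
      ((T + 30) * Suc (spine r))"
    using SCons.prems by (intro SCons.IH) simp
  have first: "computes EVAL [\<phi>, SCons r xs, ts, u] (encode_bool (Q (spine r))) T"
    by (rule SCons.prems) simp
  let ?env = "[SCons a r, \<phi>, xs, ts, u]"
  have body: "eval_within (interpreter main) ?env
      (or_expr (Call EVAL [Var 1, MkCons (Tl (Var 0)) (Var 2), Var 3, Var 4])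
        (Call EXISTS [Tl (Var 0), Var 1, Var 2, Var 3, Var 4]))
      (encode_bool (Q (spine r) \<or> (\<exists>v<spine r. Q v))) (T + (T + 30) * Suc (spine r) + 20)"
    by (rule eval_within_mono[OF eval_within_or[OF eval_within_Call_straight[OF first]
            eval_within_Call_straight[OF rest]]]) simp_all
  show ?case
    by (rule computesI, unfold exists_body_def spine.simps Ex_less_Suc)
      (rule eval_within_Cond_then[OF body], simp_all)
qed

lemma computes_row:
  assumes "\<And>x. spine x < spine r \<Longrightarrow>
    computes TABULATE [m, \<phi>, SCons x xs, ts, u] (f (spine x)) T"
  shows "computes ROW [r, encode_list acc, m, \<phi>, xs, ts, u]
    (encode_list (map f [0..<spine r] @ acc)) ((T + 30) * Suc (spine r))"
  using assms
proof (induction r arbitrary: acc)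
  case SNil
  show ?case
    by (rule computesI, unfold row_body_def)
      (rule eval_within_Cond_else[OF eval_within_straight], simp_all)
next
  case (SCons a r)
  let ?env = "[SCons a r, encode_list acc, m, \<phi>, xs, ts, u]"
  let ?entry = "Call TABULATE [Var 2, Var 3, MkCons (Tl (Var 0)) (Var 4), Var 5, Var 6]"
  have entry: "eval_within (interpreter main) ?env ?entry (f (spine r)) (T + 9)"
    by (rule eval_within_mono[OF eval_within_Call_straight[OF SCons.prems[of r]]]) simp_all
  have args: "evals_within (interpreter main) ?env
      [Tl (Var 0), MkCons ?entry (Var 1), Var 2, Var 3, Var 4, Var 5, Var 6]
      [r, encode_list (f (spine r) # acc), m, \<phi>, xs, ts, u]
      (2 + ((T + 9) + 1 + 1 + (1 + (1 + (1 + (1 + (1 + 0)))))))"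
    unfolding encode_list_simps
    by (intro evals_within_Cons evals_within_Nil eval_within_MkCons entry
        eval_within_mono[OF eval_within_straight]) simp_all
  have "computes ROW [r, encode_list (f (spine r) # acc), m, \<phi>, xs, ts, u]
      (encode_list (map f [0..<spine r] @ f (spine r) # acc)) ((T + 30) * Suc (spine r))"
    using SCons.prems by (intro SCons.IH) simp
  note body = eval_within_Cond_then[OF eval_within_Call[OF args this]]
  have entries: "map f [0..<spine (SCons a r)] @ acc = map f [0..<spine r] @ f (spine r) # acc"
    by simp
  show ?case
    by (rule computesI, unfold row_body_def entries) (rule body, simp_all)
qed

definition loop_time :: "nat \<Rightarrow> nat \<Rightarrow> nat" where
  "loop_time n T = (T + 60) * Suc n"

lemma loop_time_ge: "(T + 30) * Suc n + 30 \<le> loop_time n T"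
  by (simp add: loop_time_def algebra_simps)

lemma computes_tabulate:
  assumes "\<And>ys. length ys = spine m \<Longrightarrow> \<forall>y\<in>set ys. spine y < spine u \<Longrightarrow>
    computes EVAL [\<phi>, encode_list (ys @ xs), ts, u] (f (rev (map spine ys))) T"
  shows "computes TABULATE [m, \<phi>, encode_list xs, ts, u] (tabulate (spine u) (spine m) f)
    ((loop_time (spine u) ^^ spine m) (T + 10))"
  using assms
proof (induction m arbitrary: xs f)
  case SNil
  have "computes EVAL [\<phi>, encode_list xs, ts, u] (f []) T" using SNil[of "[]"] by simp
  note body = eval_within_Cond_else[OF eval_within_Call_straight[OF this]]
  show ?case
    by (rule computesI, unfold tabulate_body_def spine.simps tabulate.simps) (rule body, simp_all)
next
  case (SCons a m)
  let ?T = "(loop_time (spine u) ^^ spine m) (T + 10)"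
  have "computes TABULATE [m, \<phi>, SCons x (encode_list xs), ts, u]
      (tabulate (spine u) (spine m) (\<lambda>ws. f (spine x # ws))) ?T" if "spine x < spine u" for x
    unfolding encode_list_simps[symmetric]
  proof (rule SCons.IH(2))
    fix ys assume "length ys = spine m" "\<forall>y\<in>set ys. spine y < spine u"
    then show "computes EVAL [\<phi>, encode_list (ys @ x # xs), ts, u]
        (f (spine x # rev (map spine ys))) T"
      using SCons.prems[of "ys @ [x]"] that by simp
  qed
  from computes_row[OF this, of u "[]"]
  have "computes ROW [u, SNil, m, \<phi>, encode_list xs, ts, u]
      (tabulate (spine u) (spine (SCons a m)) f) ((?T + 30) * Suc (spine u))"
    by simp
  note body = eval_within_Cond_then[OF eval_within_Call_straight[OF this]]
  show ?case
    by (rule computesI, unfold tabulate_body_def)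
      (rule body, use loop_time_ge[of ?T "spine u"] in simp_all)
qed

lemma computes_iterate:
  assumes step: "\<And>X R. rep X R \<Longrightarrow>
      \<exists>Y. rep Y (F R) \<and> computes TABULATE [m, \<phi>, xs, SCons X ts, u] Y T"
    and "rep X R"
  shows "\<exists>Y. rep Y ((F ^^ Suc (size c)) R) \<and>
    computes ITERATE [c, X, m, \<phi>, xs, ts, u] Y ((T + 40) * (2 * size c + 1))"
  using \<open>rep X R\<close>
proof (induction c arbitrary: X R)
  case SNil
  then obtain Y where "rep Y (F R)" and tabulate: "computes TABULATE [m, \<phi>, xs, SCons X ts, u] Y T"
    using step by blast
  have "computes ITERATE [SNil, X, m, \<phi>, xs, ts, u] Y (T + 40)"
    by (rule computesI, unfold iterate_body_def)
      (rule eval_within_Cond_else[OF eval_within_Call_straight[OF tabulate]], simp_all)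
  then show ?case using \<open>rep Y (F R)\<close> by auto
next
  case (SCons a b)
  let ?t = "\<lambda>c :: sexp. (T + 40) * (2 * size c + 1)"
  let ?env = "[SCons a b, X, m, \<phi>, xs, ts, u]"
  obtain Y where rep_Y: "rep Y ((F ^^ Suc (size a)) R)"
    and iterate_a: "computes ITERATE [a, X, m, \<phi>, xs, ts, u] Y (?t a)"
    using SCons.IH(1)[OF SCons.prems] by blast
  obtain Z where rep_Z: "rep Z ((F ^^ Suc (size b)) ((F ^^ Suc (size a)) R))"
    and iterate_b: "computes ITERATE [b, Y, m, \<phi>, xs, ts, u] Z (?t b)"
    using SCons.IH(2)[OF rep_Y] by blast
  have inner: "eval_within (interpreter main) ?env
      (Call ITERATE [Hd (Var 0), Var 1, Var 2, Var 3, Var 4, Var 5, Var 6]) Y (?t a + 9)"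
    by (rule eval_within_mono[OF eval_within_Call_straight[OF iterate_a]]) simp_all
  have args: "evals_within (interpreter main) ?env
      [Tl (Var 0), Call ITERATE [Hd (Var 0), Var 1, Var 2, Var 3, Var 4, Var 5, Var 6],
        Var 2, Var 3, Var 4, Var 5, Var 6]
      [b, Y, m, \<phi>, xs, ts, u] (2 + (?t a + 9 + (1 + (1 + (1 + (1 + (1 + 0)))))))"
    by (intro evals_within_Cons evals_within_Nil inner eval_within_mono[OF eval_within_straight])
      simp_all
  have "computes ITERATE ?env Z (?t (SCons a b))"
    by (rule computesI, unfold iterate_body_def)
      (rule eval_within_Cond_then[OF eval_within_Call[OF args iterate_b]],
        simp_all add: algebra_simps)
  moreover have "(F ^^ Suc (size b)) ((F ^^ Suc (size a)) R) = (F ^^ Suc (size (SCons a b))) R"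
    unfolding comp_apply[of "F ^^ _", symmetric] funpow_add[symmetric] by (simp add: add.commute)
  ultimately show ?case using rep_Z by auto
qed

definition represents_all :: "nat \<Rightarrow> nat list \<Rightarrow> sexp list \<Rightarrow> nat list set list \<Rightarrow> bool" where
  "represents_all n ars ts S \<longleftrightarrow> length ts = length ars \<and> length S = length ars \<and>
     (\<forall>r<length ars. represents n (ars ! r) (ts ! r) (S ! r))"

lemma represents_all_Cons [simp]:
  "represents_all n (m # ars) (x # ts) (R # S) \<longleftrightarrow> represents n m x R \<and> represents_all n ars ts S"
  by (auto simp: represents_all_def All_less_Suc2)

lemma represents_SNil: "represents n m SNil {}"
proof -
  have "sexp_nth SNil v = SNil" for v by (induction v) simp_all
  then have "lookup SNil ws = SNil" for ws by (induction ws) simp_all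
  then show ?thesis by (simp add: represents_def encode_bool_def)
qed

definition lookup_time :: "nat list \<Rightarrow> nat poly" where
  "lookup_time ks = [:10 * sum_list ks + 50 * length ks + 10, 10 * length ks:]"

definition loop_poly :: "nat poly \<Rightarrow> nat poly" where
  "loop_poly p = (p + [:60:]) * [:1, 1:]"

lemma poly_loop_poly: "poly (loop_poly p) n = loop_time n (poly p n)"
  by (simp add: loop_poly_def loop_time_def algebra_simps)

lemma poly_funpow_loop_poly: "poly ((loop_poly ^^ m) p) n = (loop_time n ^^ m) (poly p n)"
  by (induction m) (simp_all add: poly_loop_poly)

primrec eval_time :: "formula \<Rightarrow> nat poly" where
  "eval_time (Equal i j) = [:10 * i + 10 * j + 150, 10:]"
| "eval_time (Atom r ks) = lookup_time ks + [:10 * r + 150:]"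
| "eval_time (Neg \<phi>) = eval_time \<phi> + [:100:]"
| "eval_time (Conj \<phi> \<psi>) = eval_time \<phi> + eval_time \<psi> + [:100:]"
| "eval_time (Exists \<phi>) = loop_poly (eval_time \<phi>) + [:100:]"
| "eval_time (Lfp m \<phi> ks) = (let p = (loop_poly ^^ m) (eval_time \<phi> + [:10:])
     in p + (p + [:40:]) * (4 * [:1, 1:] ^ m) + lookup_time ks + [:150:])"

lemma computes_eval:
  assumes "eval_within (interpreter main) [SCons (encode_nat k) args, xs, ts, u]
      (eval_branches ! k) v S"
    and "k < 6" "S + 48 \<le> T"
  shows "computes EVAL [SCons (encode_nat k) args, xs, ts, u] v T"
proof (rule computesI, unfold eval_body_def)
  show "eval_within (interpreter main) [SCons (encode_nat k) args, xs, ts, u]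
      (switch_expr eval_branches (Hd (Var 0))) v (S + (straight_time (Hd (Var 0)) + k + 1) * Suc k)"
    using assms(1,2) by (intro eval_within_switch) (simp_all add: eval_branches_def)
  have "(straight_time (Hd (Var 0)) + k + 1) * Suc k \<le> 8 * 6"
    using \<open>k < 6\<close> by (intro mult_le_mono) simp_all
  then show "S + (straight_time (Hd (Var 0)) + k + 1) * Suc k \<le> T" using assms(3) by linarith
qed

definition evaluates :: "sexp \<Rightarrow> nat list set list \<Rightarrow> sexp list \<Rightarrow> sexp list \<Rightarrow> formula \<Rightarrow> bool" where
  "evaluates u S ts xs \<phi> \<longleftrightarrow>
     computes EVAL [encode_formula \<phi>, encode_list xs, encode_list ts, u]
       (encode_bool (holds (spine u) S (map spine xs) \<phi>)) (poly (eval_time \<phi>) (spine u))"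

lemma evaluates_Equal:
  assumes i: "i < length xs" and j: "j < length xs" and bounded: "\<forall>x\<in>set xs. spine x < spine u"
  shows "evaluates u S ts xs (Equal i j)"
proof -
  let ?env = "[encode_formula (Equal i j), encode_list xs, encode_list ts, u]"
  have holds: "holds (spine u) S (map spine xs) (Equal i j) \<longleftrightarrow> spine (xs ! i) = spine (xs ! j)"
    using i j by simp
  have args: "evals_within (interpreter main) ?env
      [Call NTH [Var 1, Hd (Tl (Var 0))], Call NTH [Var 1, Tl (Tl (Var 0))]] [xs ! i, xs ! j]
      (10 * i + 15 + (10 * j + 15 + 0))"
    by (intro evals_within_Cons evals_within_Nil
        eval_within_mono[OF eval_within_Call_straight[OF computes_nth_encode_list[OF i]]]
        eval_within_mono[OF eval_within_Call_straight[OF computes_nth_encode_list[OF j]]]) simp_all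
  have "spine (xs ! i) \<le> spine u" using bounded i by (simp add: less_imp_le)
  then have "eval_within (interpreter main) ?env (eval_branches ! 0)
      (encode_bool (spine (xs ! i) = spine (xs ! j))) (10 * i + 10 * j + 10 * spine u + 60)"
    unfolding eval_branches_nth equal_branch_def
    by (intro eval_within_mono[OF eval_within_Call[OF args computes_equal]]) simp
  then show ?thesis
    unfolding evaluates_def encode_formula.simps holds by (rule computes_eval) simp_all
qed

lemma represents_lookup:
  assumes "represents n (length ks) x R" "set ks \<subseteq> {..<length xs}" "\<forall>x\<in>set xs. spine x < n"
  shows "lookup x (map (\<lambda>k. spine (xs ! k)) ks) = encode_bool (map ((!) (map spine xs)) ks \<in> R)"
proof -
  have "map (\<lambda>k. spine (xs ! k)) ks = map ((!) (map spine xs)) ks"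
    using assms(2) by (intro map_cong) auto
  moreover have "map (\<lambda>k. spine (xs ! k)) ks \<in> tuples n (length ks)"
    using assms(2,3) by (auto simp: tuples_def)
  ultimately show ?thesis using assms(1) unfolding represents_def by metis
qed

lemma computes_lookup_represents:
  assumes "represents (spine u) (length ks) x R" "set ks \<subseteq> {..<length xs}"
    "\<forall>x\<in>set xs. spine x < spine u"
  shows "computes LOOKUP [x, encode_list (map encode_nat ks), encode_list xs]
    (encode_bool (map ((!) (map spine xs)) ks \<in> R)) (poly (lookup_time ks) (spine u))"
  unfolding represents_lookup[OF assms, symmetric]
  by (rule computes_within_mono[OF computes_lookup[of ks xs "spine u"]])
    (use assms(2,3) in \<open>auto simp: lookup_time_def algebra_simps\<close>)

lemma evaluates_Atom:
  assumes r: "r < length ts" and represents: "represents (spine u) (length ks) (ts ! r) (S ! r)"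
    and "set ks \<subseteq> {..<length xs}" "\<forall>x\<in>set xs. spine x < spine u"
  shows "evaluates u S ts xs (Atom r ks)"
proof -
  let ?env = "[encode_formula (Atom r ks), encode_list xs, encode_list ts, u]"
  have table: "eval_within (interpreter main) ?env (Call NTH [Var 2, Hd (Tl (Var 0))]) (ts ! r)
      (10 * r + 15)"
    by (rule eval_within_mono[OF eval_within_Call_straight[OF computes_nth_encode_list[OF r]]])
      simp_all
  have args: "evals_within (interpreter main) ?env
      [Call NTH [Var 2, Hd (Tl (Var 0))], Tl (Tl (Var 0)), Var 1]
      [ts ! r, encode_list (map encode_nat ks), encode_list xs] (10 * r + 15 + (3 + (1 + 0)))"
    by (intro evals_within_Cons evals_within_Nil table eval_within_mono[OF eval_within_straight])
      simp_all
  have "eval_within (interpreter main) ?env (eval_branches ! 1)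
      (encode_bool (map ((!) (map spine xs)) ks \<in> S ! r))
      (10 * r + 20 + poly (lookup_time ks) (spine u))"
    unfolding eval_branches_nth atom_branch_def
    by (rule eval_within_mono[OF eval_within_Call[OF args
            computes_lookup_represents[OF assms(2-)]]]) simp
  then show ?thesis
    unfolding evaluates_def encode_formula.simps holds.simps by (rule computes_eval) simp_all
qed

lemma evaluates_Neg:
  assumes "evaluates u S ts xs \<phi>"
  shows "evaluates u S ts xs (Neg \<phi>)"
proof -
  note call = eval_within_Call_straight[OF assms[unfolded evaluates_def]]
  have "eval_within (interpreter main) [encode_formula (Neg \<phi>), encode_list xs, encode_list ts, u]
      (eval_branches ! 2) (encode_bool (\<not> holds (spine u) S (map spine xs) \<phi>))
      (poly (eval_time \<phi>) (spine u) + 20)"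
    unfolding eval_branches_nth neg_branch_def
    by (rule eval_within_mono[OF eval_within_not[OF call]]) simp_all
  then show ?thesis
    unfolding evaluates_def encode_formula.simps holds.simps by (rule computes_eval) simp_all
qed

lemma evaluates_Conj:
  assumes "evaluates u S ts xs \<phi>" "evaluates u S ts xs \<psi>"
  shows "evaluates u S ts xs (Conj \<phi> \<psi>)"
proof -
  note calls = assms[unfolded evaluates_def, THEN eval_within_Call_straight]
  have "eval_within (interpreter main)
      [encode_formula (Conj \<phi> \<psi>), encode_list xs, encode_list ts, u]
      (eval_branches ! 3)
      (encode_bool (holds (spine u) S (map spine xs) \<phi> \<and> holds (spine u) S (map spine xs) \<psi>))
      (poly (eval_time \<phi>) (spine u) + poly (eval_time \<psi>) (spine u) + 30)"
    unfolding eval_branches_nth conj_branch_def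
    by (rule eval_within_mono[OF eval_within_and[OF calls]]) simp_all
  then show ?thesis
    unfolding evaluates_def encode_formula.simps holds.simps by (rule computes_eval) simp_all
qed

lemma evaluates_Exists:
  assumes "\<And>x. spine x < spine u \<Longrightarrow> evaluates u S ts (x # xs) \<phi>"
  shows "evaluates u S ts xs (Exists \<phi>)"
proof -
  let ?T = "poly (eval_time \<phi>) (spine u)"
  have "computes EVAL [encode_formula \<phi>, SCons x (encode_list xs), encode_list ts, u]
      (encode_bool (holds (spine u) S (spine x # map spine xs) \<phi>)) ?T" if "spine x < spine u" for x
    using assms[OF that] by (simp add: evaluates_def)
  note call = eval_within_Call_straight[OF computes_exists[OF this]]
  have "eval_within (interpreter main)
      [encode_formula (Exists \<phi>), encode_list xs, encode_list ts, u]
      (eval_branches ! 4) (encode_bool (\<exists>v<spine u. holds (spine u) S (v # map spine xs) \<phi>))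
      (loop_time (spine u) ?T)"
    unfolding eval_branches_nth exists_branch_def
    by (rule eval_within_mono[OF call]) (use loop_time_ge[of ?T "spine u"] in simp_all)
  then show ?thesis
    unfolding evaluates_def encode_formula.simps holds.simps
    by (rule computes_eval) (simp_all add: poly_loop_poly)
qed

definition stage_table ::
    "nat \<Rightarrow> nat list set list \<Rightarrow> nat list \<Rightarrow> nat \<Rightarrow> formula \<Rightarrow> nat list set \<Rightarrow> sexp" where
  "stage_table n S vs m \<phi> R = tabulate n m (\<lambda>ws. encode_bool (holds n (R # S) (rev ws @ vs) \<phi>))"

lemma represents_stage_table: "represents n m (stage_table n S vs m \<phi> R) (stage n S vs m \<phi> R)"
  by (simp add: represents_def stage_table_def lookup_tabulate stage_def)

lemma size_stage_table:
  "n ^ m \<le> Suc (size (stage_table n S vs m \<phi> R))"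
  "Suc (size (stage_table n S vs m \<phi> R)) \<le> 2 * Suc n ^ m"
  unfolding stage_table_def by (rule size_tabulate_ge size_tabulate_le; simp add: encode_bool_def)+

definition stage_time :: "nat \<Rightarrow> formula \<Rightarrow> nat \<Rightarrow> nat" where
  "stage_time m \<phi> n = (loop_time n ^^ m) (poly (eval_time \<phi>) n + 10)"

lemma computes_stage_table:
  assumes "\<And>ys. length ys = m \<Longrightarrow> \<forall>y\<in>set ys. spine y < spine u \<Longrightarrow>
    evaluates u (R # S) (X # ts) (ys @ xs) \<phi>"
  shows "computes TABULATE
      [encode_nat m, encode_formula \<phi>, encode_list xs, SCons X (encode_list ts), u]
    (stage_table (spine u) S (map spine xs) m \<phi> R) (stage_time m \<phi> (spine u))"
proof -
  have "computes EVAL [encode_formula \<phi>, encode_list (ys @ xs), SCons X (encode_list ts), u]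
      (encode_bool (holds (spine u) (R # S) (rev (rev (map spine ys)) @ map spine xs) \<phi>))
      (poly (eval_time \<phi>) (spine u))"
    if "length ys = spine (encode_nat m)" "\<forall>y\<in>set ys. spine y < spine u" for ys
    using assms[of ys] that by (simp add: evaluates_def)
  from computes_tabulate[where m = "encode_nat m", OF this] show ?thesis
    by (simp add: stage_table_def stage_time_def)
qed

definition fixpoint_time :: "nat \<Rightarrow> formula \<Rightarrow> nat \<Rightarrow> nat" where
  "fixpoint_time m \<phi> n = (stage_time m \<phi> n + 40) * (4 * Suc n ^ m)"

lemma computes_fixpoint:
  fixes u :: sexp and S :: "nat list set list" and xs :: "sexp list" and m :: nat and \<phi> :: formula
  defines "F \<equiv> stage (spine u) S (map spine xs) m \<phi>"
    and "c \<equiv> stage_table (spine u) S (map spine xs) m \<phi> {}"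
  assumes "\<And>X R ys. represents (spine u) m X R \<Longrightarrow> length ys = m \<Longrightarrow> \<forall>y\<in>set ys. spine y < spine u \<Longrightarrow>
      evaluates u (R # S) (X # ts) (ys @ xs) \<phi>"
    and "mono F"
  obtains Y where "represents (spine u) m Y (lfp F)"
    "computes ITERATE [c, SNil, encode_nat m, encode_formula \<phi>, encode_list xs, encode_list ts, u] Y
      (fixpoint_time m \<phi> (spine u))"
proof -
  let ?rep = "represents (spine u) m" and ?T = "stage_time m \<phi> (spine u)"
  have "\<exists>Y. ?rep Y (F R) \<and> computes TABULATE
      [encode_nat m, encode_formula \<phi>, encode_list xs, SCons X (encode_list ts), u] Y ?T"
    if "?rep X R" for X R
    unfolding F_def
    by (intro exI conjI, rule represents_stage_table, rule computes_stage_table,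
        rule assms(3)[OF that])
  from computes_iterate[where c = c and F = F, OF this represents_SNil]
  obtain Y where "?rep Y ((F ^^ Suc (size c)) {})" and iterate: "computes ITERATE
      [c, SNil, encode_nat m, encode_formula \<phi>, encode_list xs, encode_list ts, u] Y
      ((?T + 40) * (2 * size c + 1))"
    by blast
  moreover have "(F ^^ Suc (size c)) {} = lfp F"
    using \<open>mono F\<close> size_stage_table(1) unfolding F_def c_def by (intro funpow_stage_eq_lfp)
  ultimately have "?rep Y (lfp F)" by simp
  moreover have "2 * size c + 1 \<le> 4 * Suc (spine u) ^ m"
    using size_stage_table(2)[of "spine u" S "map spine xs" m \<phi> "{}", folded c_def] by simp
  then have "(?T + 40) * (2 * size c + 1) \<le> fixpoint_time m \<phi> (spine u)"
    unfolding fixpoint_time_def by (rule mult_le_mono2)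
  ultimately show ?thesis using that computes_within_mono[OF iterate] by blast
qed

lemma eval_within_fixpoint_expr:
  assumes evaluates: "\<And>X R ys. represents (spine u) m X R \<Longrightarrow> length ys = m \<Longrightarrow>
      \<forall>y\<in>set ys. spine y < spine u \<Longrightarrow> evaluates u (R # S) (X # ts) (ys @ xs) \<phi>"
    and "mono (stage (spine u) S (map spine xs) m \<phi>)"
  obtains Y where "represents (spine u) m Y (lfp (stage (spine u) S (map spine xs) m \<phi>))"
    "eval_within (interpreter main) [encode_formula (Lfp m \<phi> ks), encode_list xs, encode_list ts, u]
      fixpoint_expr Y (stage_time m \<phi> (spine u) + fixpoint_time m \<phi> (spine u) + 30)"
proof -
  let ?env = "[encode_formula (Lfp m \<phi> ks), encode_list xs, encode_list ts, u]"
  let ?m = "Hd (Tl (Var 0))" and ?\<phi> = "Hd (Tl (Tl (Var 0)))"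
  let ?tabulate = "Call TABULATE [?m, ?\<phi>, Var 1, MkCons MkNil (Var 2), Var 3]"
  let ?c = "stage_table (spine u) S (map spine xs) m \<phi> {}"
  obtain Y where represents: "represents (spine u) m Y (lfp (stage (spine u) S (map spine xs) m \<phi>))"
    and iterate: "computes ITERATE
      [?c, SNil, encode_nat m, encode_formula \<phi>, encode_list xs, encode_list ts, u] Y
      (fixpoint_time m \<phi> (spine u))"
    using computes_fixpoint[OF assms] by blast
  have counter: "eval_within (interpreter main) ?env ?tabulate ?c (stage_time m \<phi> (spine u) + 13)"
    by (rule eval_within_mono[OF eval_within_Call_straight[OF
            computes_stage_table[OF evaluates[OF represents_SNil]]]]) simp_all
  have args: "evals_within (interpreter main) ?env [?tabulate, MkNil, ?m, ?\<phi>, Var 1, Var 2, Var 3]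
      [?c, SNil, encode_nat m, encode_formula \<phi>, encode_list xs, encode_list ts, u]
      (stage_time m \<phi> (spine u) + 13 + (1 + (3 + (4 + (1 + (1 + (1 + 0)))))))"
    by (intro evals_within_Cons evals_within_Nil counter eval_within_mono[OF eval_within_straight])
      simp_all
  show ?thesis
    by (rule that[OF represents], unfold fixpoint_expr_def Let_def,
        rule eval_within_mono[OF eval_within_Call[OF args iterate]]) simp
qed

lemma evaluates_Lfp:
  assumes evaluates: "\<And>X R ys. represents (spine u) m X R \<Longrightarrow> length ys = m \<Longrightarrow>
      \<forall>y\<in>set ys. spine y < spine u \<Longrightarrow> evaluates u (R # S) (X # ts) (ys @ xs) \<phi>"
    and mono: "mono (stage (spine u) S (map spine xs) m \<phi>)"
    and ks: "length ks = m" "set ks \<subseteq> {..<length xs}" and bounded: "\<forall>x\<in>set xs. spine x < spine u"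
  shows "evaluates u S ts xs (Lfp m \<phi> ks)"
proof -
  let ?env = "[encode_formula (Lfp m \<phi> ks), encode_list xs, encode_list ts, u]"
  let ?R = "lfp (stage (spine u) S (map spine xs) m \<phi>)"
  let ?T = "stage_time m \<phi> (spine u) + fixpoint_time m \<phi> (spine u)"
  obtain Y where represents: "represents (spine u) m Y ?R"
    and fixpoint: "eval_within (interpreter main) ?env fixpoint_expr Y (?T + 30)"
    by (rule eval_within_fixpoint_expr[OF evaluates mono])
  have args: "evals_within (interpreter main) ?env [fixpoint_expr, Tl (Tl (Tl (Var 0))), Var 1]
      [Y, encode_list (map encode_nat ks), encode_list xs] (?T + 30 + (4 + (1 + 0)))"
    by (intro evals_within_Cons evals_within_Nil fixpoint eval_within_mono[OF eval_within_straight])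
      simp_all
  have "computes LOOKUP [Y, encode_list (map encode_nat ks), encode_list xs]
      (encode_bool (map ((!) (map spine xs)) ks \<in> ?R)) (poly (lookup_time ks) (spine u))"
    using represents ks bounded by (intro computes_lookup_represents) simp_all
  from eval_within_Call[OF args this]
  have "eval_within (interpreter main) ?env (eval_branches ! 5)
      (encode_bool (map ((!) (map spine xs)) ks \<in> ?R)) (?T + 36 + poly (lookup_time ks) (spine u))"
    unfolding eval_branches_nth lfp_branch_def by (rule eval_within_mono) simp
  then show ?thesis
    unfolding evaluates_def encode_formula.simps holds_Lfp
    by (rule computes_eval)
      (simp_all add: Let_def stage_time_def fixpoint_time_def poly_funpow_loop_poly algebra_simps)
qed

lemma evaluates_well_formed:
  assumes "well_formed ars (length xs) \<phi>" "represents_all (spine u) ars ts S"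
    and "\<forall>x\<in>set xs. spine x < spine u"
  shows "evaluates u S ts xs \<phi>"
  using assms
proof (induction \<phi> arbitrary: ars S ts xs)
  case (Equal i j)
  then show ?case by (intro evaluates_Equal) simp_all
next
  case (Atom r ks)
  then show ?case by (intro evaluates_Atom) (auto simp: represents_all_def)
next
  case (Neg \<phi>)
  then show ?case by (intro evaluates_Neg) simp
next
  case (Conj \<phi> \<psi>)
  then show ?case by (intro evaluates_Conj Conj.IH[of ars]) simp_all
next
  case (Exists \<phi>)
  then show ?case by (intro evaluates_Exists) simp
next
  case (Lfp m \<phi> ks)
  show ?case
  proof (rule evaluates_Lfp)
    fix X R and ys :: "sexp list"
    assume "represents (spine u) m X R" "length ys = m" "\<forall>y\<in>set ys. spine y < spine u"
    then show "evaluates u (R # S) (X # ts) (ys @ xs) \<phi>"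
      using Lfp.prems by (intro Lfp.IH[of "m # ars"]) auto
  qed (use Lfp.prems in simp_all)
qed

end

lemma poly_nat_mono: "m \<le> n \<Longrightarrow> poly p m \<le> poly p n" for p :: "nat poly"
  by (induction p) (simp_all add: add_le_mono mult_le_mono)

lemma decides_in_poly_time_cong:
  "decides_in_poly_time P enc D Q \<Longrightarrow> (\<And>x. x \<in> D \<Longrightarrow> Q x \<longleftrightarrow> Q' x) \<Longrightarrow>
    decides_in_poly_time P enc D Q'"
  by (simp add: decides_in_poly_time_def)

text \<open>The first table, a list with an entry for every element, doubles as the universe.\<close>

theorem definable_imp_decidable_in_poly_time:
  assumes wf: "well_formed ars 0 \<phi>"
    and enc: "\<And>x. x \<in> D \<Longrightarrow> \<exists>ts. enc x = encode_list ts \<and>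
      represents_all (n x) ars ts (S x) \<and> spine (shd (enc x)) = n x"
  shows "\<exists>P. decides_in_poly_time P enc D (\<lambda>x. holds (n x) (S x) [] \<phi>)"
proof -
  define main where "main = Call EVAL [constant_expr (encode_formula \<phi>), MkNil, Var 0, Hd (Var 0)]"
  define p where "p = eval_time \<phi> + [:2 * size (encode_formula \<phi>) + 10:]"
  have "\<exists>v t. runs (interpreter main) (enc x) v t \<and> t \<le> poly p (size (enc x)) \<and>
      (v \<noteq> SNil \<longleftrightarrow> holds (n x) (S x) [] \<phi>)" if "x \<in> D" for x
  proof -
    let ?answer = "encode_bool (holds (n x) (S x) [] \<phi>)"
    obtain ts where "enc x = encode_list ts" "represents_all (n x) ars ts (S x)"
      and size: "spine (shd (enc x)) = n x"
      using enc[OF \<open>x \<in> D\<close>] by blast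
    then have eval: "computes_within (interpreter main) EVAL
        [encode_formula \<phi>, SNil, enc x, shd (enc x)] ?answer (poly (eval_time \<phi>) (n x))"
      using evaluates_well_formed[of ars "[]" \<phi> "shd (enc x)" ts "S x" main] wf
      by (simp add: evaluates_def)
    have args: "evals_within (interpreter main) [enc x]
        [constant_expr (encode_formula \<phi>), MkNil, Var 0, Hd (Var 0)]
        [encode_formula \<phi>, SNil, enc x, shd (enc x)]
        (2 * size (encode_formula \<phi>) + 1 + (1 + (1 + (2 + 0))))"
      by (intro evals_within_Cons evals_within_Nil eval_within_constant
          eval_within_mono[OF eval_within_straight]) simp_all
    have "computes_within (interpreter main) 0 [enc x] ?answer
        (2 * size (encode_formula \<phi>) + 1 + (1 + (1 + (2 + 0))) + poly (eval_time \<phi>) (n x) + 1)"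
      using eval_within_Call[OF args eval]
      by (simp add: computes_within_def interpreter_def main_def)
    then have "eval_within (interpreter main) [enc x] (Call 0 [Var 0]) ?answer (poly p (n x))"
      by (rule eval_within_mono[OF eval_within_Call_straight]) (simp_all add: p_def)
    moreover have "n x \<le> size (enc x)"
      unfolding size[symmetric] using spine_le_size[of "shd (enc x)"] by (cases "enc x") simp_all
    then have "poly p (n x) \<le> poly p (size (enc x))" by (rule poly_nat_mono)
    ultimately show ?thesis
      unfolding runs_def eval_within_def by (meson encode_bool_eq_SNil order_trans)
  qed
  then show ?thesis unfolding decides_in_poly_time_def by blast
qed

section \<open>Connectivity as a formula\<close>

abbreviation Disj :: "formula \<Rightarrow> formula \<Rightarrow> formula" where
  "Disj \<phi> \<psi> \<equiv> Neg (Conj (Neg \<phi>) (Neg \<psi>))"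

abbreviation Imp :: "formula \<Rightarrow> formula \<Rightarrow> formula" where
  "Imp \<phi> \<psi> \<equiv> Neg (Conj \<phi> (Neg \<psi>))"

abbreviation Forall :: "formula \<Rightarrow> formula" where
  "Forall \<phi> \<equiv> Neg (Exists (Neg \<phi>))"

definition unary_relation :: "nat set \<Rightarrow> nat list set" where
  "unary_relation A = (\<lambda>v. [v]) ` A"

definition binary_relation :: "(nat \<times> nat) set \<Rightarrow> nat list set" where
  "binary_relation R = (\<lambda>(u, v). [u, v]) ` R"

definition quaternary_relation :: "(nat \<times> nat \<times> nat \<times> nat) set \<Rightarrow> nat list set" where
  "quaternary_relation R = (\<lambda>(i, u, j, w). [i, u, j, w]) ` R"

lemma mem_relation_iff [simp]:
  "[v] \<in> unary_relation A \<longleftrightarrow> v \<in> A"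
  "[u, v] \<in> binary_relation B \<longleftrightarrow> (u, v) \<in> B"
  "[i, u, j, w] \<in> quaternary_relation C \<longleftrightarrow> (i, u, j, w) \<in> C"
  by (force simp: unary_relation_def binary_relation_def quaternary_relation_def)+

definition apart_formula :: "nat \<Rightarrow> nat \<Rightarrow> formula" where
  "apart_formula x y = Conj (Neg (Equal x y)) (Neg (Atom 1 [x, y]))"

text \<open>The three rules of \<^const>\<open>pair_closure\<close> for the tuple \<open>(i, u', j, w')\<close>. The relations are the
  closure itself (\<open>0\<close>), the adjacency relation (\<open>1\<close>) and the start set (\<open>s\<close>). The comments list the
  variables \<open>0, 1, \<dots>\<close> that are in scope.\<close>

definition start_rule :: "nat \<Rightarrow> formula" where \<comment> \<open>\<open>w', j, u', i\<close>\<close>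
  "start_rule s = Conj (Conj (Atom s [3]) (Atom s [1])) (Conj (Equal 3 2) (Equal 1 0))"

definition swap_rule :: formula where \<comment> \<open>\<open>w', j, u', i\<close>\<close>
  "swap_rule = Atom 0 [1, 0, 3, 2]"

definition unblocked_formula :: "nat \<Rightarrow> formula" where \<comment> \<open>\<open>x, l, w, u, w', j, u', i\<close>\<close>
  "unblocked_formula s = Forall (Imp (Conj (Atom s [0]) (Neg (Equal 0 6)))
     (Exists (Conj (Atom 0 [7, 3, 1, 0]) (apart_formula 0 6))))"

definition move_rule :: "nat \<Rightarrow> formula" where \<comment> \<open>\<open>w, u, w', j, u', i\<close>\<close>
  "move_rule s = Exists (Exists (Conj (Atom 0 [5, 1, 3, 0]) (Conj (Atom 1 [1, 4])
     (Conj (unblocked_formula s)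
       (Disj (Conj (Equal 5 3) (Equal 2 4))
         (Conj (Neg (Equal 5 3)) (Conj (Equal 2 0) (apart_formula 0 4))))))))"

definition closure_rules :: "nat \<Rightarrow> formula" where
  "closure_rules s = Disj (start_rule s) (Disj swap_rule (move_rule s))"

lemmas closure_rules_defs = closure_rules_def start_rule_def swap_rule_def move_rule_def
  unblocked_formula_def apart_formula_def

lemma tuples_4_iff: "ws \<in> tuples n 4 \<longleftrightarrow>
    (\<exists>i u j w. ws = [i, u, j, w] \<and> i < n \<and> u < n \<and> j < n \<and> w < n)"
  by (auto simp: tuples_def numeral_eq_Suc length_Suc_conv)

lemma holds_closure_rules:
  "holds n (X # S) (w' # j # u' # i # vs) (closure_rules (Suc s)) \<longleftrightarrow>
    [i] \<in> S ! s \<and> [j] \<in> S ! s \<and> i = u' \<and> j = w' \<or>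
    [j, w', i, u'] \<in> X \<or>
    (\<exists>u<n. \<exists>w<n. [i, u, j, w] \<in> X \<and> [u, u'] \<in> S ! 0 \<and>
      (\<forall>l<n. [l] \<in> S ! s \<and> l \<noteq> i \<longrightarrow> (\<exists>x<n. [i, u, l, x] \<in> X \<and> x \<noteq> u' \<and> [x, u'] \<notin> S ! 0)) \<and>
      (i = j \<and> w' = u' \<or> i \<noteq> j \<and> w' = w \<and> w \<noteq> u' \<and> [w, u'] \<notin> S ! 0))"
  by (simp add: closure_rules_defs numeral_eq_Suc) blast

lemma mono_stage_closure_rules:
  assumes "0 < s"
  shows "mono (stage n S vs 4 (closure_rules s))"
proof (rule monoI)
  fix X Y :: "nat list set" assume "X \<subseteq> Y"
  then have mem_imp: "ws \<in> X \<longrightarrow> ws \<in> Y" for ws by blast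
  obtain t where s: "s = Suc t" using \<open>0 < s\<close> gr0_implies_Suc by blast
  have "holds n (X # S) (w' # j # u' # i # vs) (closure_rules s) \<longrightarrow>
      holds n (Y # S) (w' # j # u' # i # vs) (closure_rules s)" for i u' j w'
    unfolding s holds_closure_rules
    by (intro disj_mono conj_mono ex_mono all_mono imp_mono mem_imp imp_refl)
  then show "stage n S vs 4 (closure_rules s) X \<subseteq> stage n S vs 4 (closure_rules s) Y"
    by (auto simp: stage_def tuples_4_iff)
qed

lemma well_formed_closure_rules:
  assumes "0 < s" "s < length (4 # 2 # ars)" "(4 # 2 # ars) ! s = 1"
  shows "well_formed (4 # 2 # ars) (4 + l) (closure_rules s)"
  using assms by (simp add: closure_rules_defs numeral_eq_Suc)

lemma pair_closure_bounded:
  assumes "\<And>u v. adj u v \<Longrightarrow> u \<in> V \<and> v \<in> V" "I \<subseteq> V" "(i, u, j, w) \<in> pair_closure adj I"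
  shows "i \<in> V \<and> u \<in> V \<and> j \<in> V \<and> w \<in> V"
  using assms(3) by (induction rule: pair_closure.induct) (use assms(1,2) in auto)

lemma lfp_closure_rules_subset:
  assumes "I \<subseteq> {..<n}" and S_nth: "S ! 0 = binary_relation E" "S ! s = unary_relation I"
  shows "lfp (stage n S vs 4 (closure_rules (Suc s))) \<subseteq>
    quaternary_relation (pair_closure (\<lambda>u v. (u, v) \<in> E) I)" (is "_ \<subseteq> quaternary_relation ?C")
proof (rule lfp_lowerbound, rule subsetI)
  fix ws assume "ws \<in> stage n S vs 4 (closure_rules (Suc s)) (quaternary_relation ?C)"
  then obtain i u' j w' where ws: "ws = [i, u', j, w']"
    and "holds n (quaternary_relation ?C # S) (w' # j # u' # i # vs) (closure_rules (Suc s))"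
    by (auto simp: stage_def tuples_4_iff)
  then consider (start) "i \<in> I" "j \<in> I" "i = u'" "j = w'"
    | (swap) "(j, w', i, u') \<in> ?C"
    | (move) u w where "(i, u, j, w) \<in> ?C" "(u, u') \<in> E"
      "\<forall>l\<in>I - {i}. \<exists>x. (i, u, l, x) \<in> ?C \<and> apart (\<lambda>u v. (u, v) \<in> E) x u'"
      "i = j \<and> w' = u' \<or> i \<noteq> j \<and> w' = w \<and> apart (\<lambda>u v. (u, v) \<in> E) w u'"
    using \<open>I \<subseteq> {..<n}\<close> unfolding holds_closure_rules S_nth mem_relation_iff apart_def by blast
  then have "(i, u', j, w') \<in> ?C"
    by cases (auto intro: pair_closure.start pair_closure.swap pair_closure.move)
  then show "ws \<in> quaternary_relation ?C" by (simp add: ws)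
qed

lemma pair_closure_imp_lfp_closure_rules:
  assumes arcs: "\<And>u v. (u, v) \<in> E \<Longrightarrow> u < n \<and> v < n" and "I \<subseteq> {..<n}"
    and S_nth: "S ! 0 = binary_relation E" "S ! s = unary_relation I"
    and "(i, u, j, w) \<in> pair_closure (\<lambda>u v. (u, v) \<in> E) I"
  shows "[i, u, j, w] \<in> lfp (stage n S vs 4 (closure_rules (Suc s)))" (is "_ \<in> ?L")
  using assms(5)
proof (induction rule: pair_closure.induct)
  have bounded: "i < n \<and> u < n \<and> j < n \<and> w < n"
    if "(i, u, j, w) \<in> pair_closure (\<lambda>u v. (u, v) \<in> E) I" for i u j w
    using pair_closure_bounded[of "\<lambda>u v. (u, v) \<in> E" "{..<n}"] arcs \<open>I \<subseteq> {..<n}\<close> that by auto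
  have lfpI: "[i, u', j, w'] \<in> ?L" if "i < n" "u' < n" "j < n" "w' < n"
    "holds n (?L # S) (w' # j # u' # i # vs) (closure_rules (Suc s))" for i u' j w'
    using that
    by (subst lfp_unfold[OF mono_stage_closure_rules[OF zero_less_Suc]])
      (simp add: stage_def tuples_4_iff)
  {
    case (start i j)
    then show ?case
      using \<open>I \<subseteq> {..<n}\<close> by (intro lfpI) (auto simp: holds_closure_rules S_nth)
  next
    case (swap j w i u)
    then show ?case
      using bounded[OF swap.hyps] by (intro lfpI) (auto simp: holds_closure_rules S_nth)
  next
    case (move i u j w u' w')
    have "u' < n" "w' < n" using move.hyps bounded[OF move.hyps(1)] arcs by auto
    moreover have "\<forall>l\<in>I - {i}. \<exists>x<n. [i, u, l, x] \<in> ?L \<and> apart (\<lambda>u v. (u, v) \<in> E) x u'"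
      using move.IH(2) bounded by blast
    moreover have "holds n (?L # S) (w' # j # u' # i # vs) (closure_rules (Suc s))"
      unfolding holds_closure_rules S_nth mem_relation_iff
      using calculation bounded[OF move.hyps(1)] move.IH(1) move.hyps
      by (intro disjI2 exI[of _ u] exI[of _ w]) (auto simp: apart_def)
    ultimately show ?case using bounded[OF move.hyps(1)] by (intro lfpI) auto
  }
qed

lemma lfp_closure_rules:
  assumes "\<And>u v. (u, v) \<in> E \<Longrightarrow> u < n \<and> v < n" "I \<subseteq> {..<n}"
    and "S ! 0 = binary_relation E" "S ! s = unary_relation I"
  shows "lfp (stage n S vs 4 (closure_rules (Suc s))) =
    quaternary_relation (pair_closure (\<lambda>u v. (u, v) \<in> E) I)"
  using lfp_closure_rules_subset[OF assms(2-)] pair_closure_imp_lfp_closure_rules[OF assms]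
  by (auto simp: quaternary_relation_def)

definition same_range_formula :: formula where \<comment> \<open>\<open>j, i\<close>\<close>
  "same_range_formula = Forall
     (let in_range_i = Lfp 4 (closure_rules 2) [2, 0, 2, 0];
          in_range_j = Lfp 4 (closure_rules 3) [1, 0, 1, 0]
      in Conj (Imp in_range_i in_range_j) (Imp in_range_j in_range_i))"

definition connectivity_formula :: formula where
  "connectivity_formula = Forall (Imp (Atom 1 [0]) (Exists (Conj (Atom 2 [0]) same_range_formula)))"

lemma well_formed_connectivity_formula: "well_formed [2, 1, 1] 0 connectivity_formula"
  using well_formed_closure_rules[of 2 "[1, 1]" 3] well_formed_closure_rules[of 3 "[1, 1]" 3]
  by (simp add: connectivity_formula_def same_range_formula_def mono_stage_closure_rules Let_def)

lemma holds_same_range_formula: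
  assumes arcs: "\<And>u v. (u, v) \<in> E \<Longrightarrow> u < n \<and> v < n"
    and I_bounded: "I \<subseteq> {..<n}" and J_bounded: "J \<subseteq> {..<n}"
  defines "R \<equiv> token_range (\<lambda>u v. (u, v) \<in> E)"
  shows "holds n [binary_relation E, unary_relation I, unary_relation J] [j, i] same_range_formula \<longleftrightarrow>
    R I i = R J j"
proof -
  let ?S = "[binary_relation E, unary_relation I, unary_relation J]"
  have range_I: "holds n ?S [x, j, i] (Lfp 4 (closure_rules 2) [2, 0, 2, 0]) \<longleftrightarrow> x \<in> R I i" for x
    using lfp_closure_rules[OF arcs I_bounded, where S = ?S and s = 1]
    by (simp add: holds_Lfp R_def token_range_def numeral_eq_Suc del: holds.simps One_nat_def)
  have range_J: "holds n ?S [x, j, i] (Lfp 4 (closure_rules 3) [1, 0, 1, 0]) \<longleftrightarrow> x \<in> R J j" for x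
    using lfp_closure_rules[OF arcs J_bounded, where S = ?S and s = 2]
    by (simp add: holds_Lfp R_def token_range_def numeral_eq_Suc del: holds.simps One_nat_def)
  have "R A i \<subseteq> {..<n}" if "A \<subseteq> {..<n}" for A i
    using pair_closure_bounded[of "\<lambda>u v. (u, v) \<in> E" "{..<n}" A] arcs that
    by (auto simp: R_def token_range_def)
  from this[OF I_bounded, of i] this[OF J_bounded, of j]
  have "R I i = R J j \<longleftrightarrow> (\<forall>x<n. x \<in> R I i \<longleftrightarrow> x \<in> R J j)" by blast
  then show ?thesis
    by (simp add: same_range_formula_def Let_def range_I range_J iff_conv_conj_imp
        del: holds.simps(6) One_nat_def)
qed

lemma holds_connectivity_formula:
  assumes "\<And>u v. (u, v) \<in> E \<Longrightarrow> u < n \<and> v < n" "I \<subseteq> {..<n}" "J \<subseteq> {..<n}"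
  defines "R \<equiv> token_range (\<lambda>u v. (u, v) \<in> E)"
  shows "holds n [binary_relation E, unary_relation I, unary_relation J] [] connectivity_formula \<longleftrightarrow>
    (\<forall>i\<in>I. \<exists>j\<in>J. R I i = R J j)"
  using assms(2,3)
  by (simp add: connectivity_formula_def holds_same_range_formula[OF assms(1-3)] flip: R_def) blast

section \<open>The algorithm\<close>

lemma represents_encode_set: "represents n 1 (encode_set n A) (unary_relation A)"
  by (auto simp: represents_def tuples_def length_Suc_conv encode_set_def sexp_nth_encode_list)

lemma represents_encode_graph:
  assumes "pverts G = {..<n}"
  shows "represents n 2 (encode_graph G) (binary_relation (parcs G))"
  using assms represents_encode_set
  by (auto simp: represents_def tuples_def numeral_2_eq_2 length_Suc_conv encode_graph_def
      encode_set_def sexp_nth_encode_list)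

definition ts_instances :: "ts_instance set" where
  "ts_instances = {(G, k, I, J). interval_graph G \<and> (\<exists>n. pverts G = {..<n}) \<and>
     I \<in> independent_sets G k \<and> J \<in> independent_sets G k}"

lemma ts_instancesE:
  assumes "x \<in> ts_instances"
  obtains G k I J n where "x = (G, k, I, J)" "interval_graph G" "pverts G = {..<n}"
    "I \<in> independent_sets G k" "J \<in> independent_sets G k"
  using assms by (auto simp: ts_instances_def)

fun instance_structure :: "ts_instance \<Rightarrow> nat list set list" where
  "instance_structure (G, k, I, J) =
     [binary_relation (parcs G), unary_relation I, unary_relation J]"

fun instance_size :: "ts_instance \<Rightarrow> nat" where
  "instance_size (G, k, I, J) = card (pverts G)"

lemma represents_encode_instance:
  assumes "x \<in> ts_instances"
  shows "\<exists>ts. encode_instance x = encode_list ts \<and>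
    represents_all (instance_size x) [2, 1, 1] ts (instance_structure x) \<and>
    spine (shd (encode_instance x)) = instance_size x"
  using assms
proof (rule ts_instancesE)
  fix G k I J n
  assume x: "x = (G, k, I, J)" and verts: "pverts G = {..<n}"
  have "represents_all (instance_size x) [2, 1, 1]
      [encode_graph G, encode_set n I, encode_set n J] (instance_structure x)"
    using represents_encode_graph[OF verts] represents_encode_set
    by (simp add: x verts represents_all_def[of _ "[]"])
  moreover have "spine (shd (encode_instance x)) = instance_size x"
    by (simp add: x encode_graph_def Let_def)
  moreover have "encode_instance x = encode_list [encode_graph G, encode_set n I, encode_set n J]"
    by (simp add: x verts)
  ultimately show ?thesis by blast
qed

lemma holds_connectivity_formula_iff_same_component:
  assumes "x \<in> ts_instances"
  shows "holds (instance_size x) (instance_structure x) [] connectivity_formula \<longleftrightarrow>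
    (case x of (G, k, I, J) \<Rightarrow> same_component (TS k G) I J)"
  using assms
proof (rule ts_instancesE)
  fix G k I J n
  assume x: "x = (G, k, I, J)" and "interval_graph G" and verts: "pverts G = {..<n}"
    and independent: "I \<in> independent_sets G k" "J \<in> independent_sets G k"
  then obtain prec where "interval_ordered_graph G prec"
    using interval_graph_imp_ordered by blast
  then interpret interval_ordered_graph G prec .
  have "u < n \<and> v < n" if "(u, v) \<in> parcs G" for u v
    using wellformed[OF that] verts by auto
  moreover have "I \<subseteq> {..<n}" "J \<subseteq> {..<n}"
    using independent verts by (auto simp: independent_sets_def)
  ultimately show ?thesis
    using holds_connectivity_formula[of "parcs G" n I J]
    by (simp add: x verts same_component_iff_token_ranges[OF independent])
qed

theorem theorem3:
  shows "\<exists>P :: program.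
    decides_in_poly_time P encode_instance
      {(G, k, I, J). interval_graph G \<and> (\<exists>n. pverts G = {..<n}) \<and>
         I \<in> independent_sets G k \<and> J \<in> independent_sets G k}
      (\<lambda>(G, k, I, J). same_component (TS k G) I J)"
proof -
  have "\<exists>P. decides_in_poly_time P encode_instance ts_instances
      (\<lambda>x. holds (instance_size x) (instance_structure x) [] connectivity_formula)"
    using well_formed_connectivity_formula represents_encode_instance
    by (rule definable_imp_decidable_in_poly_time)
  then obtain P where "decides_in_poly_time P encode_instance ts_instances
      (\<lambda>x. holds (instance_size x) (instance_structure x) [] connectivity_formula)" ..
  then have "decides_in_poly_time P encode_instance ts_instances
      (\<lambda>(G, k, I, J). same_component (TS k G) I J)"
    using holds_connectivity_formula_iff_same_component by (rule decides_in_poly_time_cong)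
  then show ?thesis unfolding ts_instances_def ..
qed

end
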